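(* Let $1\le k\le n/2$ and $Q_0,Q_1\in\mathrm{Gr}(k,n)$, with $Q_0=V_0I_{k,n-k}V_0^{\mathsf T}$, $Q_1=V_1I_{k,n-k}V_1^{\mathsf T}$, $V_0,V_1\in\mathrm{O}(n)$. Let \[ V_0^{\mathsf T}V_1=\begin{bmatrix}U&0\\0&V\end{bmatrix}\begin{bmatrix}\cos\Theta&\sin\Theta&0\\-\sin\Theta&\cos\Theta&0\\0&0&I_{n-2k}\end{bmatrix}\begin{bmatrix}W&0\\0&Z\end{bmatrix}^{\mathsf T} \] be a CS decomposition, where $U,W\in\mathrm{O}(k)$, $V,Z\in\mathrm{O}(n-k)$, $\Theta=\operatorname{diag}(\theta_1,\dots,\theta_k)$, $\theta_i\in[0,\pi/2]$, and let $B=-2U[\Theta,0]V^{\mathsf T}\in\mathbb{R}^{k\times(n-k)}$ with $0\in\mathbb{R}^{k\times(n-2k)}$. Then the geodesic distance between $Q_0$ and $Q_1$ is \[ d(Q_0,Q_1)=\sqrt2\Bigl(\sum_{i=1}^k\sigma_i(B)^2\Bigr)^{1/2}=2\sqrt2\Bigl(\sum_{i=1}^k\theta_i^2\Bigr)^{1/2}. \]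
   Context: $\mathrm{Gr}(k,n)=\{Q\in\mathrm{O}(n):Q^{\mathsf T}=Q,\ \operatorname{tr}(Q)=2k-n\}$, an embedded submanifold of $\mathbb{R}^{n\times n}$, equipped with the Riemannian metric $\langle X,Y\rangle_Q=\operatorname{tr}(XY)$ for $X,Y\in\mathbb{T}_Q\mathrm{Gr}(k,n)$ (tangent vectors are symmetric matrices); $d$ is the associated Riemannian (geodesic) distance. $I_{k,n-k}=\operatorname{diag}(I_k,-I_{n-k})$. $\cos\Theta$ and $\sin\Theta$ are the diagonal matrices $\operatorname{diag}(\cos\theta_i)$, $\operatorname{diag}(\sin\theta_i)$; $\sigma_1(B),\dots,\sigma_k(B)$ are the singular values of $B$. *)

theory Defs
  imports
    "HOL-Analysis.Analysis"
    "Jordan_Normal_Form.Char_Poly"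
    "HOL-Computational_Algebra.Fundamental_Theorem_Algebra"
begin

definition mat_trace :: "real mat \<Rightarrow> real" where
  "mat_trace A = (\<Sum>i<dim_row A. A $$ (i, i))"

definition orth_group :: "nat \<Rightarrow> real mat set" where
  "orth_group n = {Q \<in> carrier_mat n n. Q\<^sup>T * Q = 1\<^sub>m n}"

definition Gr :: "nat \<Rightarrow> nat \<Rightarrow> real mat set" where
  "Gr k n = {Q \<in> orth_group n. Q\<^sup>T = Q \<and> mat_trace Q = 2 * real k - real n}"

text \<open>The matrix \<open>I\<^bsub>k,m\<^esub> = diag(I\<^sub>k, -I\<^sub>m)\<close>.\<close>

definition sig_mat :: "nat \<Rightarrow> nat \<Rightarrow> real mat" where
  "sig_mat k m = diag_block_mat [1\<^sub>m k, - 1\<^sub>m m]"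

definition append_cols :: "'a :: zero mat \<Rightarrow> 'a mat \<Rightarrow> 'a mat" where
  "append_cols A B = four_block_mat A B (0\<^sub>m 0 (dim_col A)) (0\<^sub>m 0 (dim_col B))"

text \<open>
  All \<open>min p q\<close> singular values of a real \<open>p \<times> q\<close> matrix, with multiplicity and in
  decreasing order: the square roots of the eigenvalues of the smaller of the two Gram matrices.
  That matrix is symmetric, so its characteristic polynomial splits over the reals and
  \<open>proots\<close> has as many elements as the matrix has rows.
  Indexing starts at 0: the \<open>i\<close>-th singular value in the usual numbering is
  \<open>singular_values A ! (i - 1)\<close>.
\<close>

definition singular_values :: "real mat \<Rightarrow> real list" where
  "singular_values A =
     rev (sorted_list_of_multiset (image_mset sqrt (proots (char_poly
       (if dim_row A \<le> dim_col A then A * A\<^sup>T else A\<^sup>T * A)))))"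

text \<open>
  Curves in a subset of the \<open>n \<times> n\<close> matrices. The type of matrices carries no topology, so
  differentiability is required entrywise. On each closed piece the derivative is
  one-sided at the end points and continuous up to them. The library predicate
  \<open>piecewise_C1_differentiable_on\<close> is not used because it admits derivatives that are
  unbounded near a break point; such a curve can be non-rectifiable, and then the
  integral defining its length would be 0 by convention.
\<close>

definition C1_on :: "(real \<Rightarrow> real) \<Rightarrow> real set \<Rightarrow> bool" where
  "C1_on f S \<longleftrightarrow>
     (\<exists>f'. (\<forall>t\<in>S. (f has_real_derivative f' t) (at t within S)) \<and> continuous_on S f')"

definition piecewise_C1_curve :: "nat \<Rightarrow> real mat set \<Rightarrow> (real \<Rightarrow> real mat) \<Rightarrow> bool" where
  "piecewise_C1_curve n M \<gamma> \<longleftrightarrow>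
     (\<forall>t\<in>{0..1}. \<gamma> t \<in> M) \<and>
     (\<exists>(m::nat) (p :: nat \<Rightarrow> real). p 0 = 0 \<and> p m = 1 \<and>
        (\<forall>l<m. p l < p (Suc l) \<and>
           (\<forall>i<n. \<forall>j<n. C1_on (\<lambda>t. \<gamma> t $$ (i, j)) {p l..p (Suc l)})))"

definition velocity :: "nat \<Rightarrow> (real \<Rightarrow> real mat) \<Rightarrow> real \<Rightarrow> real mat" where
  "velocity n \<gamma> t = Matrix.mat n n (\<lambda>(i, j). deriv (\<lambda>s. \<gamma> s $$ (i, j)) t)"

text \<open>
  The velocity is unspecified at the finitely many break points, which does not affect the length.
  A metric \<open>g\<close> takes the base point and two tangent vectors there.
\<close>

definition curve_length ::
  "nat \<Rightarrow> (real mat \<Rightarrow> real mat \<Rightarrow> real mat \<Rightarrow> real) \<Rightarrow> (real \<Rightarrow> real mat) \<Rightarrow> real" where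
  "curve_length n g \<gamma> =
     integral {0..1} (\<lambda>t. sqrt (g (\<gamma> t) (velocity n \<gamma> t) (velocity n \<gamma> t)))"

text \<open>
  The Riemannian distance on an embedded submanifold \<open>M\<close> of the \<open>n \<times> n\<close> matrices. As \<open>M\<close> is
  embedded, a curve is \<open>C\<^sup>1\<close> in \<open>M\<close> iff it is \<open>C\<^sup>1\<close> as a matrix-valued function with values in \<open>M\<close>,
  and its velocity is then a tangent vector of \<open>M\<close>.
\<close>

definition riemannian_dist ::
  "nat \<Rightarrow> real mat set \<Rightarrow> (real mat \<Rightarrow> real mat \<Rightarrow> real mat \<Rightarrow> real) \<Rightarrow>
   real mat \<Rightarrow> real mat \<Rightarrow> real" where
  "riemannian_dist n M g P Q =
     Inf {curve_length n g \<gamma> | \<gamma>. piecewise_C1_curve n M \<gamma> \<and> \<gamma> 0 = P \<and> \<gamma> 1 = Q}"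

definition trace_metric :: "real mat \<Rightarrow> real mat \<Rightarrow> real mat \<Rightarrow> real" where
  "trace_metric Q X Y = mat_trace (X * Y)"

definition Gr_dist :: "nat \<Rightarrow> nat \<Rightarrow> real mat \<Rightarrow> real mat \<Rightarrow> real" where
  "Gr_dist k n = riemannian_dist n (Gr k n) trace_metric"

end

(* Lower bound.  In the frame in which Q0 = I_{k,n-k} and Q1 is the rotated matrix, the i-th diagonal
   entry (i <= k) of Q1 is cos (2 theta_i), so the function
     f S = sum_i theta_i * arccos (S_ii)
   grows by 2 |theta|^2 from Q0 to Q1.  Tangent vectors at S anticommute with S, and projecting the
   gradient of f to the tangent space leaves a matrix of norm at most |theta| / sqrt 2: the off-diagonal
   terms of the projection enter its squared norm with a negative sign, because all weights are
   nonnegative.  Hence every curve from Q0 to Q1 has length at least 2 sqrt 2 |theta|.  To avoid the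
   singularities of arccos at 1 and -1, f is replaced by sum_i theta_i * arccos (r * S_ii) with r < 1,
   which obeys the same gradient bound, and r tends to 1.

   Upper bound.  Replacing theta by t * theta in the rotation gives a curve of constant speed
   2 sqrt 2 |theta|.

   Singular values.  B * B^T = U * diag(4 theta_i^2) * U^T. *)

theory Submission
  imports Defs
begin

section \<open>Orthogonal conjugation and the Grassmannian\<close>

lemma orth_groupD:
  assumes "Q \<in> orth_group n"
  shows "Q \<in> carrier_mat n n" "Q\<^sup>T * Q = 1\<^sub>m n" "Q * Q\<^sup>T = 1\<^sub>m n"
proof -
  show c: "Q \<in> carrier_mat n n" and o: "Q\<^sup>T * Q = 1\<^sub>m n"
    using assms by (auto simp: orth_group_def)
  show "Q * Q\<^sup>T = 1\<^sub>m n"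
    by (rule mat_mult_left_right_inverse[OF _ c o]) (use c in simp)
qed

lemma orth_group_mult:
  assumes "A \<in> orth_group n" "B \<in> orth_group n"
  shows "A * B \<in> orth_group n"
proof -
  note A = orth_groupD[OF assms(1)] and B = orth_groupD[OF assms(2)]
  have "(A * B)\<^sup>T * (A * B) = B\<^sup>T * (A\<^sup>T * A) * B"
    using A(1) B(1) by (simp add: transpose_mult[of _ n n _ n] assoc_mult_mat[of _ n n _ n _ n])
  also have "\<dots> = 1\<^sub>m n" using A B by simp
  finally show ?thesis using A(1) B(1) by (simp add: orth_group_def)
qed

lemma orth_group_transpose: "A \<in> orth_group n \<Longrightarrow> A\<^sup>T \<in> orth_group n"
  by (frule orth_groupD(3)) (auto simp: orth_group_def)

lemma symmetric_mat_entry: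
  assumes "A \<in> carrier_mat n n" "A\<^sup>T = A" "i < n" "j < n"
  shows "A $$ (i, j) = A $$ (j, i)"
  using assms by (metis carrier_matD index_transpose_mat(1))

lemma mat_trace_mult:
  assumes "A \<in> carrier_mat n m" "B \<in> carrier_mat m n"
  shows "mat_trace (A * B) = (\<Sum>i<n. \<Sum>j<m. A $$ (i, j) * B $$ (j, i))"
  using assms unfolding mat_trace_def
  by (auto simp: scalar_prod_def atLeast0LessThan intro!: sum.cong)

lemma mat_trace_mult_commute:
  assumes "A \<in> carrier_mat n m" "B \<in> carrier_mat m n"
  shows "mat_trace (A * B) = mat_trace (B * A)"
  unfolding mat_trace_mult[OF assms] mat_trace_mult[OF assms(2,1)]
  by (subst sum.swap) (simp add: mult.commute)

lemma mat_trace_conj: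
  assumes "M \<in> orth_group n" "A \<in> carrier_mat n n"
  shows "mat_trace (M * A * M\<^sup>T) = mat_trace A"
proof -
  note M = orth_groupD[OF assms(1)]
  have "mat_trace (M * A * M\<^sup>T) = mat_trace (M * (A * M\<^sup>T))"
    using M(1) assms(2) by (simp add: assoc_mult_mat[of _ n n _ n _ n])
  also have "\<dots> = mat_trace (A * M\<^sup>T * M)"
    using M(1) assms(2) by (intro mat_trace_mult_commute[of _ n n]) auto
  also have "A * M\<^sup>T * M = A"
    using M(1,2) assms(2) by (simp add: assoc_mult_mat[of _ n n _ n _ n])
  finally show ?thesis .
qed

lemma conj_mult:
  assumes "M \<in> orth_group n" "A \<in> carrier_mat n n" "B \<in> carrier_mat n n"
  shows "(M * A * M\<^sup>T) * (M * B * M\<^sup>T) = M * (A * B) * M\<^sup>T"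
proof -
  note M = orth_groupD[OF assms(1)]
  have "(M * A * M\<^sup>T) * (M * B * M\<^sup>T) = M * A * (M\<^sup>T * M) * B * M\<^sup>T"
    using M(1) assms(2,3) by (simp add: assoc_mult_mat[of _ n n _ n _ n])
  also have "\<dots> = M * (A * B) * M\<^sup>T"
    unfolding M(2) using M(1) assms(2,3) by (simp add: assoc_mult_mat[of _ n n _ n _ n])
  finally show ?thesis .
qed

lemma conj_conj_transpose:
  assumes "M \<in> orth_group n" "A \<in> carrier_mat n n"
  shows "M\<^sup>T * (M * A * M\<^sup>T) * M = A"
proof -
  note M = orth_groupD[OF assms(1)]
  have "M\<^sup>T * (M * A * M\<^sup>T) * M = (M\<^sup>T * M) * A * (M\<^sup>T * M)"
    using M(1) assms(2) by (simp add: assoc_mult_mat[of _ n n _ n _ n])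
  then show ?thesis using M assms(2) by simp
qed

lemma transpose_conj:
  fixes M A :: "'a :: comm_semiring_0 mat"
  assumes "M \<in> carrier_mat n n" "A \<in> carrier_mat n n"
  shows "(M * A * M\<^sup>T)\<^sup>T = M * A\<^sup>T * M\<^sup>T"
proof -
  have "(M * A * M\<^sup>T)\<^sup>T = M\<^sup>T\<^sup>T * (M * A)\<^sup>T"
    by (rule transpose_mult[of _ n n _ n]) (use assms in simp_all)
  also have "(M * A)\<^sup>T = A\<^sup>T * M\<^sup>T"
    using assms by (rule transpose_mult)
  finally show ?thesis
    using assms by (simp add: assoc_mult_mat[of _ n n _ n _ n])
qed

lemma Gr_D:
  assumes "Q \<in> Gr k n"
  shows "Q \<in> carrier_mat n n" "Q\<^sup>T = Q" "Q * Q = 1\<^sub>m n"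
  using assms orth_groupD[of Q n] by (auto simp: Gr_def)

text \<open>Used to move a curve into a frame in which both end points are in normal form.
  Orthogonal conjugation keeps symmetry, orthogonality and trace.\<close>

lemma Gr_conj:
  assumes "M \<in> orth_group n" "Q \<in> Gr k n"
  shows "M * Q * M\<^sup>T \<in> Gr k n"
proof -
  have Q: "Q \<in> carrier_mat n n" "Q\<^sup>T = Q" "Q \<in> orth_group n" "mat_trace Q = 2 * real k - real n"
    using assms(2) Gr_D(1) by (auto simp: Gr_def)
  note M = orth_groupD[OF assms(1)]
  show ?thesis unfolding Gr_def
    using Q orth_group_mult[OF orth_group_mult[OF assms(1) Q(3)] orth_group_transpose[OF assms(1)]]
    by (simp add: transpose_conj[OF M(1) Q(1)] mat_trace_conj[OF assms(1)])
qed

section \<open>The lower bound for the length of a curve\<close>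

text \<open>
  The left-hand side is the Frobenius inner product of \<open>X\<close> with the diagonal matrix \<open>D = diag(g)\<close>.
  As \<open>X\<close> anticommutes with \<open>S\<close>, \<open>D\<close> may be replaced by its projection \<open>(D - S D S) / 2\<close>, whose
  squared norm is \<open>(\<Sum>i. g\<^sub>i\<^sup>2 - \<Sum>i j. g\<^sub>i g\<^sub>j S\<^sub>i\<^sub>j\<^sup>2) / 2\<close>; for nonnegative
  \<open>g\<close> the off-diagonal terms only help.
\<close>

lemma diag_tangent_bound:
  fixes S X :: "real mat" and g :: "nat \<Rightarrow> real"
  assumes S: "S \<in> carrier_mat n n" "S\<^sup>T = S" "S * S = 1\<^sub>m n"
    and X: "X \<in> carrier_mat n n" "X\<^sup>T = X" "S * X + X * S = 0\<^sub>m n n"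
    and g: "\<And>i. i < n \<Longrightarrow> 0 \<le> g i"
  shows "(\<Sum>i<n. g i * X $$ (i, i))\<^sup>2
    \<le> (\<Sum>i<n. (g i)\<^sup>2 * (1 - (S $$ (i, i))\<^sup>2)) / 2 * mat_trace (X * X)"
proof -
  have Ssym: "S $$ (i, j) = S $$ (j, i)" if "i < n" "j < n" for i j
    using symmetric_mat_entry S(1,2) that .
  have Xsym: "X $$ (i, j) = X $$ (j, i)" if "i < n" "j < n" for i j
    using symmetric_mat_entry X(1,2) that .
  have SS: "(\<Sum>l<n. S $$ (i, l) * S $$ (l, j)) = (if i = j then 1 else 0)"
    if "i < n" "j < n" for i j
    using arg_cong[OF S(3), of "\<lambda>A. A $$ (i, j)"] that S(1)
    by (simp add: scalar_prod_def atLeast0LessThan)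
  have SX: "(\<Sum>l<n. S $$ (i, l) * X $$ (l, j)) = - (\<Sum>l<n. X $$ (i, l) * S $$ (l, j))"
    if "i < n" "j < n" for i j
    using arg_cong[OF X(3), of "\<lambda>A. A $$ (i, j)"] that S(1) X(1)
    by (simp add: scalar_prod_def atLeast0LessThan)
  \<comment> \<open>\<open>H\<close> is \<open>D - S D S\<close>, twice the projection of
    \<open>D\<close>; this is where the factor 2 in \<open>HX\<close> comes from.\<close>
  define H where "H i j = (if i = j then g i else 0) - (\<Sum>l<n. S $$ (i, l) * g l * S $$ (l, j))"
    for i j
  \<comment> \<open>As \<open>S X = - X S\<close> and \<open>S S = 1\<close>, the trace of
    \<open>S D S X\<close> is minus the trace of \<open>D X\<close>.\<close>
  have tr1: "(\<Sum>i<n. \<Sum>j<n. (\<Sum>l<n. S $$ (i, l) * g l * S $$ (l, j)) * X $$ (i, j))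
      = - (\<Sum>l<n. g l * X $$ (l, l))"
  proof -
    have "(\<Sum>i<n. \<Sum>j<n. (\<Sum>l<n. S $$ (i, l) * g l * S $$ (l, j)) * X $$ (i, j))
        = (\<Sum>i<n. \<Sum>j<n. \<Sum>l<n. g l * (S $$ (l, j) * (S $$ (i, l) * X $$ (i, j))))"
      by (simp add: sum_distrib_left sum_distrib_right mult_ac)
    also have "\<dots> = (\<Sum>i<n. \<Sum>l<n. \<Sum>j<n. g l * (S $$ (l, j) * (S $$ (i, l) * X $$ (i, j))))"
      by (intro sum.cong refl sum.swap)
    also have "\<dots> = (\<Sum>l<n. \<Sum>i<n. \<Sum>j<n. g l * (S $$ (l, j) * (S $$ (i, l) * X $$ (i, j))))"
      by (rule sum.swap)
    also have "\<dots> = (\<Sum>l<n. g l * (\<Sum>i<n. S $$ (i, l) * (\<Sum>j<n. S $$ (l, j) * X $$ (j, i))))"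
      by (intro sum.cong refl) (auto simp: sum_distrib_left mult_ac Xsym intro!: sum.cong)
    also have "\<dots> = (\<Sum>l<n. g l * (\<Sum>i<n. S $$ (i, l) * - (\<Sum>j<n. X $$ (l, j) * S $$ (j, i))))"
      by (intro sum.cong refl) (simp add: SX)
    also have "\<dots> = - (\<Sum>l<n. g l * (\<Sum>i<n. \<Sum>j<n. X $$ (l, j) * (S $$ (j, i) * S $$ (i, l))))"
      by (simp add: sum_distrib_left sum_negf mult_ac)
    also have "\<dots> = - (\<Sum>l<n. g l * (\<Sum>j<n. X $$ (l, j) * (\<Sum>i<n. S $$ (j, i) * S $$ (i, l))))"
      by (subst sum.swap) (simp add: sum_distrib_left)
    also have "\<dots> = - (\<Sum>l<n. g l * (\<Sum>j<n. X $$ (l, j) * (if j = l then 1 else 0)))"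
      by (simp add: SS)
    also have "\<dots> = - (\<Sum>l<n. g l * X $$ (l, l))"
      by (simp add: if_distrib[of "(*) _"] sum.delta cong: if_cong)
    finally show ?thesis .
  qed
  have HX: "(\<Sum>i<n. \<Sum>j<n. H i j * X $$ (i, j)) = 2 * (\<Sum>i<n. g i * X $$ (i, i))"
    unfolding H_def left_diff_distrib sum_subtractf tr1
    by (simp add: if_distrib[of "\<lambda>x. x * _"] sum.delta cong: if_cong)
  have HH: "(\<Sum>i<n. \<Sum>j<n. (H i j)\<^sup>2)
      = 2 * (\<Sum>i<n. (g i)\<^sup>2) - 2 * (\<Sum>i<n. \<Sum>j<n. g i * g j * (S $$ (i, j))\<^sup>2)"
  proof -
    let ?P = "\<lambda>i j. \<Sum>l<n. S $$ (i, l) * g l * S $$ (l, j)"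
    have 1: "(\<Sum>i<n. \<Sum>j<n. (if i = j then g i else 0)\<^sup>2) = (\<Sum>i<n. (g i)\<^sup>2)"
      by (simp add: if_distrib[of "\<lambda>x. x\<^sup>2"] sum.delta cong: if_cong)
    have 2: "(\<Sum>i<n. \<Sum>j<n. (if i = j then g i else 0) * ?P i j)
        = (\<Sum>i<n. \<Sum>j<n. g i * g j * (S $$ (i, j))\<^sup>2)"
      by (simp add: if_distrib[of "\<lambda>x. x * _"] sum.delta cong: if_cong)
        (auto simp: sum_distrib_left power2_eq_square mult_ac Ssym intro!: sum.cong)
    \<comment> \<open>Conjugation by the symmetric involution \<open>S\<close> preserves the
      Frobenius norm, so the squared norm of \<open>D\<close> comes out again.\<close>
    have 3: "(\<Sum>i<n. \<Sum>j<n. (?P i j)\<^sup>2) = (\<Sum>i<n. (g i)\<^sup>2)"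
    proof -
      have PS: "(\<Sum>j<n. ?P i j * S $$ (j, l)) = S $$ (i, l) * g l" if il: "i < n" "l < n" for i l
      proof -
        have "(\<Sum>j<n. ?P i j * S $$ (j, l))
            = (\<Sum>j<n. \<Sum>m<n. S $$ (i, m) * g m * (S $$ (m, j) * S $$ (j, l)))"
          by (simp add: sum_distrib_right mult.assoc)
        also have "\<dots> = (\<Sum>m<n. S $$ (i, m) * g m * (\<Sum>j<n. S $$ (m, j) * S $$ (j, l)))"
          by (subst sum.swap) (simp add: sum_distrib_left)
        also have "\<dots> = (\<Sum>m<n. S $$ (i, m) * g m * (if m = l then 1 else 0))"
          using il by (simp add: SS)
        finally show ?thesis
          using il by (simp add: if_distrib[of "(*) _"] sum.delta cong: if_cong)
      qed
      have "(\<Sum>j<n. (?P i j)\<^sup>2) = (\<Sum>l<n. (g l)\<^sup>2 * (S $$ (l, i) * S $$ (i, l)))" if i: "i < n" for i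
      proof -
        have "(\<Sum>j<n. (?P i j)\<^sup>2) = (\<Sum>j<n. \<Sum>l<n. ?P i j * (S $$ (i, l) * g l * S $$ (l, j)))"
          by (simp only: power2_eq_square sum_distrib_left)
        also have "\<dots> = (\<Sum>l<n. \<Sum>j<n. S $$ (i, l) * g l * (?P i j * S $$ (l, j)))"
          by (subst sum.swap) (simp only: mult_ac)
        also have "\<dots> = (\<Sum>l<n. S $$ (i, l) * g l * (\<Sum>j<n. ?P i j * S $$ (j, l)))"
          unfolding sum_distrib_left[symmetric]
          by (intro sum.cong refl arg_cong2[of _ _ _ _ "(*)"]) (auto simp: Ssym)
        also have "\<dots> = (\<Sum>l<n. (g l)\<^sup>2 * (S $$ (l, i) * S $$ (i, l)))"
          using i by (intro sum.cong refl, subst PS) (auto simp: Ssym power2_eq_square)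
        finally show ?thesis .
      qed
      then have "(\<Sum>i<n. \<Sum>j<n. (?P i j)\<^sup>2)
          = (\<Sum>i<n. \<Sum>l<n. (g l)\<^sup>2 * (S $$ (l, i) * S $$ (i, l)))"
        by simp
      also have "\<dots> = (\<Sum>l<n. (g l)\<^sup>2 * (\<Sum>i<n. S $$ (l, i) * S $$ (i, l)))"
        by (subst sum.swap) (simp add: sum_distrib_left)
      also have "\<dots> = (\<Sum>i<n. (g i)\<^sup>2)"
        by (simp add: SS)
      finally show ?thesis .
    qed
    have "(\<Sum>i<n. \<Sum>j<n. (H i j)\<^sup>2) = (\<Sum>i<n. \<Sum>j<n. (if i = j then g i else 0)\<^sup>2)
        + (\<Sum>i<n. \<Sum>j<n. (?P i j)\<^sup>2) - 2 * (\<Sum>i<n. \<Sum>j<n. (if i = j then g i else 0) * ?P i j)"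
      unfolding H_def power2_diff sum_subtractf sum.distrib sum_distrib_left by (simp add: mult.assoc)
    then show ?thesis unfolding 1 2 3 by simp
  qed
  have "(\<Sum>i<n. (g i)\<^sup>2 * (S $$ (i, i))\<^sup>2) \<le> (\<Sum>i<n. \<Sum>j<n. g i * g j * (S $$ (i, j))\<^sup>2)"
  proof (rule sum_mono)
    fix i assume i: "i \<in> {..<n}"
    have "(g i)\<^sup>2 * (S $$ (i, i))\<^sup>2 = (\<lambda>j. g i * g j * (S $$ (i, j))\<^sup>2) i"
      by (simp add: power2_eq_square)
    also have "\<dots> \<le> (\<Sum>j<n. g i * g j * (S $$ (i, j))\<^sup>2)"
      by (rule member_le_sum) (use i g in auto)
    finally show "(g i)\<^sup>2 * (S $$ (i, i))\<^sup>2 \<le> (\<Sum>j<n. g i * g j * (S $$ (i, j))\<^sup>2)" .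
  qed
  then have H_le: "(\<Sum>i<n. \<Sum>j<n. (H i j)\<^sup>2) \<le> 2 * (\<Sum>i<n. (g i)\<^sup>2 * (1 - (S $$ (i, i))\<^sup>2))"
    unfolding HH by (simp add: right_diff_distrib sum_subtractf)
  have trX: "mat_trace (X * X) = (\<Sum>i<n. \<Sum>j<n. (X $$ (i, j))\<^sup>2)"
    unfolding mat_trace_mult[OF X(1) X(1)]
    by (auto simp: power2_eq_square Xsym intro!: sum.cong)
  \<comment> \<open>Cauchy-Schwarz for the Frobenius inner product, with matrices read as vectors
    indexed by pairs.\<close>
  have "(2 * (\<Sum>i<n. g i * X $$ (i, i)))\<^sup>2
      = (\<Sum>p\<in>{..<n} \<times> {..<n}. H (fst p) (snd p) * X $$ p)\<^sup>2"
    unfolding HX[symmetric] by (simp add: sum.cartesian_product case_prod_beta)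
  also have "\<dots> \<le> (\<Sum>p\<in>{..<n} \<times> {..<n}. (H (fst p) (snd p))\<^sup>2) * (\<Sum>p\<in>{..<n} \<times> {..<n}. (X $$ p)\<^sup>2)"
    by (rule Cauchy_Schwarz_ineq_sum)
  also have "\<dots> = (\<Sum>i<n. \<Sum>j<n. (H i j)\<^sup>2) * mat_trace (X * X)"
    unfolding trX by (simp add: sum.cartesian_product case_prod_beta)
  also have "\<dots> \<le> 2 * (\<Sum>i<n. (g i)\<^sup>2 * (1 - (S $$ (i, i))\<^sup>2)) * mat_trace (X * X)"
    by (rule mult_right_mono[OF H_le]) (auto simp: trX intro!: sum_nonneg)
  finally show ?thesis by (simp add: power_mult_distrib mult.commute)
qed

section \<open>Entrywise calculus for matrix-valued functions\<close>

definition mat_has_deriv :: "nat \<Rightarrow> (real \<Rightarrow> real mat) \<Rightarrow> real mat \<Rightarrow> real filter \<Rightarrow> bool" where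
  "mat_has_deriv n X X' F \<longleftrightarrow>
     (\<forall>i<n. \<forall>j<n. ((\<lambda>t. X t $$ (i, j)) has_real_derivative X' $$ (i, j)) F)"

lemma mat_has_deriv_const:
  "A \<in> carrier_mat n n \<Longrightarrow> mat_has_deriv n (\<lambda>t. A) (0\<^sub>m n n) F"
  by (simp add: mat_has_deriv_def)

lemma mat_has_deriv_mult:
  assumes X: "mat_has_deriv n X X' (at x within T)" "\<And>t. t \<in> T \<Longrightarrow> X t \<in> carrier_mat n n"
      "X' \<in> carrier_mat n n"
    and Y: "mat_has_deriv n Y Y' (at x within T)" "\<And>t. t \<in> T \<Longrightarrow> Y t \<in> carrier_mat n n"
      "Y' \<in> carrier_mat n n"
    and x: "x \<in> T"
  shows "mat_has_deriv n (\<lambda>t. X t * Y t) (X' * Y x + X x * Y') (at x within T)"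
  unfolding mat_has_deriv_def
proof (intro allI impI)
  fix i j assume ij: "i < n" "j < n"
  have entry: "(A * B) $$ (i, j) = (\<Sum>l<n. A $$ (i, l) * B $$ (l, j))"
    if "A \<in> carrier_mat n n" "B \<in> carrier_mat n n" for A B :: "real mat"
    using that ij by (simp add: scalar_prod_def atLeast0LessThan)
  have "((\<lambda>t. \<Sum>l<n. X t $$ (i, l) * Y t $$ (l, j)) has_real_derivative
      (\<Sum>l<n. X' $$ (i, l) * Y x $$ (l, j) + Y' $$ (l, j) * X x $$ (i, l))) (at x within T)"
    by (intro DERIV_sum DERIV_mult) (use X(1) Y(1) ij in \<open>auto simp: mat_has_deriv_def\<close>)
  then have "((\<lambda>t. (X t * Y t) $$ (i, j)) has_real_derivative
      (\<Sum>l<n. X' $$ (i, l) * Y x $$ (l, j) + Y' $$ (l, j) * X x $$ (i, l))) (at x within T)"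
    \<comment> \<open>The two functions agree on all of \<open>T\<close>, so the radius 1 is
      arbitrary.\<close>
    by (rule has_field_derivative_transform_within[where d = 1])
       (simp_all add: x entry X Y del: index_mult_mat(1))
  moreover have "(X' * Y x + X x * Y') $$ (i, j)
      = (\<Sum>l<n. X' $$ (i, l) * Y x $$ (l, j) + Y' $$ (l, j) * X x $$ (i, l))"
    using X(2)[OF x] Y(2)[OF x] X(3) Y(3) ij entry
    by (simp add: sum.distrib mult.commute del: index_mult_mat(1))
  ultimately show "((\<lambda>t. (X t * Y t) $$ (i, j)) has_real_derivative
      (X' * Y x + X x * Y') $$ (i, j)) (at x within T)"
    by simp
qed

lemma mat_has_deriv_conj:
  assumes X: "mat_has_deriv n X X' (at x within T)" "\<And>t. t \<in> T \<Longrightarrow> X t \<in> carrier_mat n n"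
      "X' \<in> carrier_mat n n"
    and AB: "A \<in> carrier_mat n n" "B \<in> carrier_mat n n" and x: "x \<in> T"
  shows "mat_has_deriv n (\<lambda>t. A * X t * B) (A * X' * B) (at x within T)"
proof -
  have AX: "A * X x \<in> carrier_mat n n" "A * X' \<in> carrier_mat n n" "A * X' * B \<in> carrier_mat n n"
    using assms by auto
  have "mat_has_deriv n (\<lambda>t. A * X t) (0\<^sub>m n n * X x + A * X') (at x within T)"
    by (rule mat_has_deriv_mult[OF mat_has_deriv_const]) (use assms in auto)
  also have "0\<^sub>m n n * X x + A * X' = A * X'"
    using AX X(2)[OF x] by simp
  finally have "mat_has_deriv n (\<lambda>t. A * X t * B) (A * X' * B + A * X x * 0\<^sub>m n n) (at x within T)"
    by (rule mat_has_deriv_mult[OF _ _ _ mat_has_deriv_const]) (use assms in auto)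
  also have "A * X' * B + A * X x * 0\<^sub>m n n = A * X' * B"
    using right_mult_zero_mat[OF AX(1), of n] right_add_zero_mat[OF AX(3)] by metis
  finally show ?thesis .
qed

text \<open>Needed to differentiate an identity that holds along one piece of a curve: at the end
  points of the piece only one-sided derivatives are available.\<close>

lemma has_real_derivative_unique_Icc:
  fixes f :: "real \<Rightarrow> real"
  assumes "a < b" "x \<in> {a..b}" "(f has_real_derivative D) (at x within {a..b})"
    "(f has_real_derivative D') (at x within {a..b})"
  shows "D = D'"
  using vector_derivative_unique_within_closed_interval[of a b x f D D'] assms
  by (simp add: has_real_derivative_iff_has_vector_derivative)

lemma mat_has_deriv_unique_Icc:
  assumes "a < b" "x \<in> {a..b}" "mat_has_deriv n X D (at x within {a..b})"
    "mat_has_deriv n X D' (at x within {a..b})" "D \<in> carrier_mat n n" "D' \<in> carrier_mat n n"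
  shows "D = D'"
proof (rule eq_matI)
  fix i j assume "i < dim_row D'" "j < dim_col D'"
  then have "i < n" "j < n" using assms(6) by auto
  then show "D $$ (i, j) = D' $$ (i, j)"
    using assms(3,4) has_real_derivative_unique_Icc[OF assms(1,2)] unfolding mat_has_deriv_def by blast
qed (use assms(5,6) in auto)

lemma mat_has_deriv_cong:
  assumes "mat_has_deriv n X D (at x within T)" "x \<in> T"
    "\<And>t i j. t \<in> T \<Longrightarrow> i < n \<Longrightarrow> j < n \<Longrightarrow> X t $$ (i, j) = Y t $$ (i, j)"
  shows "mat_has_deriv n Y D (at x within T)"
  unfolding mat_has_deriv_def
proof (intro allI impI)
  fix i j assume ij: "i < n" "j < n"
  with assms(1) have "((\<lambda>t. X t $$ (i, j)) has_real_derivative D $$ (i, j)) (at x within T)"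
    by (simp add: mat_has_deriv_def)
  then show "((\<lambda>t. Y t $$ (i, j)) has_real_derivative D $$ (i, j)) (at x within T)"
    by (rule has_field_derivative_transform_within[where d = 1]) (use assms ij in auto)
qed

text \<open>Differentiate the identities \<open>Q\<^sup>T = Q\<close> and \<open>Q * Q = 1\<close>
  along the curve. Uniqueness of the derivative within the interval turns each of them into an
  equation for \<open>X\<close>.\<close>

lemma Gr_curve_tangent:
  assumes ab: "a < b" "x \<in> {a..b}" and \<gamma>: "\<And>t. t \<in> {a..b} \<Longrightarrow> \<gamma> t \<in> Gr k n"
    and X: "mat_has_deriv n \<gamma> X (at x within {a..b})" "X \<in> carrier_mat n n"
  shows "X\<^sup>T = X" "\<gamma> x * X + X * \<gamma> x = 0\<^sub>m n n"
proof -
  note G = Gr_D[OF \<gamma>]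
  have "((\<lambda>t. \<gamma> t $$ (i, j)) has_real_derivative X $$ (j, i)) (at x within {a..b})"
    if ij: "i < n" "j < n" for i j
  proof (rule has_field_derivative_transform_within[where d = 1])
    show "((\<lambda>t. \<gamma> t $$ (j, i)) has_real_derivative X $$ (j, i)) (at x within {a..b})"
      using X(1) ij by (simp add: mat_has_deriv_def)
  qed (use ab ij symmetric_mat_entry[OF G(1,2)] in auto)
  then have "mat_has_deriv n \<gamma> (X\<^sup>T) (at x within {a..b})"
    using X(2) by (simp add: mat_has_deriv_def)
  then show "X\<^sup>T = X"
    by (rule mat_has_deriv_unique_Icc[OF ab _ X(1)]) (use X(2) in simp_all)
  have "mat_has_deriv n (\<lambda>t. \<gamma> t * \<gamma> t) (X * \<gamma> x + \<gamma> x * X) (at x within {a..b})"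
    by (rule mat_has_deriv_mult) (use ab X G in auto)
  moreover have "mat_has_deriv n (\<lambda>t. \<gamma> t * \<gamma> t) (0\<^sub>m n n) (at x within {a..b})"
    by (rule mat_has_deriv_cong[OF mat_has_deriv_const[of "1\<^sub>m n"] ab(2)])
       (use G(3) in auto)
  ultimately have "X * \<gamma> x + \<gamma> x * X = 0\<^sub>m n n"
    by (rule mat_has_deriv_unique_Icc[OF ab]) (use X(2) G(1)[OF ab(2)] in auto)
  then show "\<gamma> x * X + X * \<gamma> x = 0\<^sub>m n n"
    using X(2) G(1)[OF ab(2)] by (subst comm_add_mat[of _ n n]) auto
qed

text \<open>Each row of an orthogonal matrix is a unit vector. This keeps the arguments of
  \<open>arccos\<close> inside its domain.\<close>

lemma Gr_diag_le:
  assumes "Q \<in> Gr k n" "i < n"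
  shows "(Q $$ (i, i))\<^sup>2 \<le> 1"
proof -
  note Q = Gr_D[OF assms(1)]
  have sym: "Q $$ (l, i) = Q $$ (i, l)" if "l < n" for l
    using symmetric_mat_entry Q(1,2) that assms(2) .
  have "(\<Sum>l<n. Q $$ (i, l) * Q $$ (l, i)) = 1"
    using arg_cong[OF Q(3), of "\<lambda>A. A $$ (i, i)"] assms(2) Q(1)
    by (simp add: scalar_prod_def atLeast0LessThan)
  then have "(\<Sum>l<n. (Q $$ (i, l))\<^sup>2) = 1"
    by (simp add: sym power2_eq_square)
  then show ?thesis
    using member_le_sum[of i "{..<n}" "\<lambda>l. (Q $$ (i, l))\<^sup>2"] assms(2) by simp
qed

section \<open>The weighted sum of diagonal angles and its growth along curves\<close>

text \<open>For orthogonal \<open>S\<close> and \<open>r = 1\<close>, each summand is a weight times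
  the angle between a basis vector and its image under \<open>S\<close>.\<close>

definition diag_angle :: "nat \<Rightarrow> real \<Rightarrow> (nat \<Rightarrow> real) \<Rightarrow> real mat \<Rightarrow> real" where
  "diag_angle n r w S = (\<Sum>i<n. w i * arccos (r * S $$ (i, i)))"

text \<open>\<open>diag_tangent_bound\<close> is applied with \<open>g i\<close> the absolute value
  of the derivative of the \<open>i\<close>-th summand in the \<open>i\<close>-th diagonal entry
  \<open>q\<close>. Since \<open>r\<^sup>2 * (1 - q\<^sup>2) \<le> 1 - (r * q)\<^sup>2\<close>, the
  term \<open>(g i)\<^sup>2 * (1 - q\<^sup>2)\<close> is at most \<open>(w i)\<^sup>2\<close>, so
  the constant depends neither on \<open>r\<close> nor on \<open>Q\<close>.\<close>

lemma diag_angle_deriv_le: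
  assumes Q: "Q \<in> Gr k n" and X: "X \<in> carrier_mat n n" "X\<^sup>T = X" "Q * X + X * Q = 0\<^sub>m n n"
    and w: "\<And>i. i < n \<Longrightarrow> 0 \<le> w i" and r: "0 \<le> r" "r < 1"
  shows "(\<Sum>i<n. w i * (- (r * X $$ (i, i)) / sqrt (1 - (r * Q $$ (i, i))\<^sup>2)))
    \<le> sqrt ((\<Sum>i<n. (w i)\<^sup>2) / 2) * sqrt (mat_trace (X * X))"
proof -
  define g where "g i = w i * r / sqrt (1 - (r * Q $$ (i, i))\<^sup>2)" for i
  \<comment> \<open>Strictness comes from \<open>r < 1\<close> and keeps the square roots in the
    denominators positive.\<close>
  have lt: "(r * Q $$ (i, i))\<^sup>2 < 1" if "i < n" for i
  proof -
    have "r\<^sup>2 * (Q $$ (i, i))\<^sup>2 \<le> r\<^sup>2 * 1"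
      by (intro mult_left_mono Gr_diag_le[OF Q that]) simp
    also have "\<dots> < 1" using r by (simp add: power_less_one_iff)
    finally show ?thesis by (simp add: power_mult_distrib)
  qed
  have g0: "0 \<le> g i" if "i < n" for i
    using lt[OF that] w[OF that] r by (simp add: g_def)
  have gw: "(g i)\<^sup>2 * (1 - (Q $$ (i, i))\<^sup>2) \<le> (w i)\<^sup>2" if "i < n" for i
  proof -
    have "r\<^sup>2 * (1 - (Q $$ (i, i))\<^sup>2) \<le> 1 - (r * Q $$ (i, i))\<^sup>2"
      using r by (simp add: power_mult_distrib right_diff_distrib power_le_one)
    then have "r\<^sup>2 * (1 - (Q $$ (i, i))\<^sup>2) / (1 - (r * Q $$ (i, i))\<^sup>2) \<le> 1"
      using lt[OF that] by (simp add: divide_le_eq)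
    then have "(w i)\<^sup>2 * (r\<^sup>2 * (1 - (Q $$ (i, i))\<^sup>2) / (1 - (r * Q $$ (i, i))\<^sup>2)) \<le> (w i)\<^sup>2 * 1"
      by (intro mult_left_mono) auto
    then show ?thesis
      using lt[OF that] by (simp add: g_def power_divide power_mult_distrib mult.assoc)
  qed
  have tr0: "0 \<le> mat_trace (X * X)"
  proof -
    have "X $$ (j, i) = X $$ (i, j)" if "i < n" "j < n" for i j
      using symmetric_mat_entry X(1,2) that(2,1) .
    then show ?thesis
      unfolding mat_trace_mult[OF X(1) X(1)] by (auto intro!: sum_nonneg)
  qed
  have "(\<Sum>i<n. w i * (- (r * X $$ (i, i)) / sqrt (1 - (r * Q $$ (i, i))\<^sup>2)))
      = - (\<Sum>i<n. g i * X $$ (i, i))"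
    by (simp add: g_def sum_negf mult.assoc)
  also have "\<dots> \<le> sqrt ((\<Sum>i<n. g i * X $$ (i, i))\<^sup>2)"
    by simp
  also have "\<dots> \<le> sqrt ((\<Sum>i<n. (g i)\<^sup>2 * (1 - (Q $$ (i, i))\<^sup>2)) / 2 * mat_trace (X * X))"
    by (intro real_sqrt_le_mono diag_tangent_bound[OF Gr_D[OF Q] X g0])
  also have "\<dots> \<le> sqrt ((\<Sum>i<n. (w i)\<^sup>2) / 2 * mat_trace (X * X))"
    by (intro real_sqrt_le_mono mult_right_mono divide_right_mono sum_mono gw tr0) auto
  finally show ?thesis by (simp only: real_sqrt_mult)
qed

text \<open>The angle function is differentiated along the curve seen in the frame \<open>M\<close>,
  the gradient bound is applied pointwise, and the fundamental theorem of calculus integrates the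
  result.\<close>

lemma diag_angle_le_length_piece:
  assumes ab: "a < b" and \<gamma>: "\<And>t. t \<in> {a..b} \<Longrightarrow> \<gamma> t \<in> Gr k n"
    and C1: "\<And>i j. i < n \<Longrightarrow> j < n \<Longrightarrow> C1_on (\<lambda>t. \<gamma> t $$ (i, j)) {a..b}"
    and M: "M \<in> orth_group n"
    and w: "\<And>i. i < n \<Longrightarrow> 0 \<le> w i" and r: "0 \<le> r" "r < 1"
  defines "F \<equiv> \<lambda>t. sqrt (trace_metric (\<gamma> t) (velocity n \<gamma> t) (velocity n \<gamma> t))"
    and "h \<equiv> \<lambda>t. diag_angle n r w (M * \<gamma> t * M\<^sup>T)"
  shows "F integrable_on {a..b}"
    and "h b - h a \<le> sqrt ((\<Sum>i<n. (w i)\<^sup>2) / 2) * integral {a..b} F"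
proof -
  from C1 have "\<forall>i. \<forall>j. \<exists>f'. i < n \<longrightarrow> j < n \<longrightarrow>
      (\<forall>t\<in>{a..b}. ((\<lambda>t. \<gamma> t $$ (i, j)) has_real_derivative f' t) (at t within {a..b})) \<and>
      continuous_on {a..b} f'"
    by (auto simp: C1_on_def)
  then obtain f' where f': "\<And>i j t. i < n \<Longrightarrow> j < n \<Longrightarrow> t \<in> {a..b} \<Longrightarrow>
      ((\<lambda>t. \<gamma> t $$ (i, j)) has_real_derivative f' i j t) (at t within {a..b})"
      and f'c: "\<And>i j. i < n \<Longrightarrow> j < n \<Longrightarrow> continuous_on {a..b} (f' i j)"
    by metis
  define X where "X t = Matrix.mat n n (\<lambda>(i, j). f' i j t)" for t
  have X: "X t \<in> carrier_mat n n" for t by (simp add: X_def)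
  have dX: "mat_has_deriv n \<gamma> (X t) (at t within {a..b})" if "t \<in> {a..b}" for t
    using f' that by (simp add: mat_has_deriv_def X_def)
  \<comment> \<open>\<open>E\<close> is the speed computed from derivatives within the interval. It
    is continuous up to the end points, whereas \<open>F\<close> uses \<open>deriv\<close>, which is
    unspecified where the curve has a corner.\<close>
  define E where "E t = sqrt (mat_trace (X t * X t))" for t
  have E: "E integrable_on {a..b}"
  proof (rule integrable_continuous_real)
    have "E = (\<lambda>t. sqrt (\<Sum>i<n. \<Sum>j<n. f' i j t * f' j i t))"
      by (rule ext, unfold E_def mat_trace_mult[OF X X]) (simp add: X_def)
    then show "continuous_on {a..b} E"
      by (auto intro!: continuous_intros f'c)
  qed
  \<comment> \<open>At interior points the derivative within the interval is two-sided, so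
    \<open>deriv\<close> returns it. The two remaining points do not affect the integral.\<close>
  have FE: "F t = E t" if "t \<in> {a..b} - {a, b}" for t
  proof -
    have "((\<lambda>t. \<gamma> t $$ (i, j)) has_real_derivative f' i j t) (at t)" if "i < n" "j < n" for i j
      using f'[OF that, of t] \<open>t \<in> {a..b} - {a, b}\<close> at_within_Icc_at[of a t b] by auto
    then have "velocity n \<gamma> t = X t"
      by (auto simp: velocity_def X_def DERIV_imp_deriv)
    then show ?thesis by (simp add: F_def E_def trace_metric_def)
  qed
  show F: "F integrable_on {a..b}"
    by (rule integrable_spike_finite[of "{a, b}", OF _ FE E]) simp_all
  have EF: "integral {a..b} E = integral {a..b} F"
    by (rule integral_spike[of "{a, b}"]) (use FE in auto)
  define h' where "h' t = (\<Sum>i<n. w i * (- (r * (M * X t * M\<^sup>T) $$ (i, i))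
      / sqrt (1 - (r * (M * \<gamma> t * M\<^sup>T) $$ (i, i))\<^sup>2)))" for t
  note Mc = orth_groupD[OF M]
  note SG = Gr_conj[OF M \<gamma>]
  have dS: "mat_has_deriv n (\<lambda>t. M * \<gamma> t * M\<^sup>T) (M * X t * M\<^sup>T) (at t within {a..b})"
    if t: "t \<in> {a..b}" for t
    by (rule mat_has_deriv_conj[OF dX[OF t] _ X]) (use Mc t Gr_D(1)[OF \<gamma>] in auto)
  have "(h' has_integral h b - h a) {a..b}"
  proof (rule fundamental_theorem_of_calculus)
    fix t assume t: "t \<in> {a..b}"
    have "((\<lambda>t. w i * arccos (r * (M * \<gamma> t * M\<^sup>T) $$ (i, i))) has_real_derivative
        w i * (- (r * (M * X t * M\<^sup>T) $$ (i, i))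
          / sqrt (1 - (r * (M * \<gamma> t * M\<^sup>T) $$ (i, i))\<^sup>2))) (at t within {a..b})"
      if i: "i < n" for i
    proof -
      have d: "((\<lambda>t. (M * \<gamma> t * M\<^sup>T) $$ (i, i)) has_real_derivative (M * X t * M\<^sup>T) $$ (i, i))
          (at t within {a..b})"
        using dS[OF t] i by (simp add: mat_has_deriv_def)
      have "\<bar>(M * \<gamma> t * M\<^sup>T) $$ (i, i)\<bar> \<le> 1"
        using Gr_diag_le[OF SG[OF t] i] abs_square_le_1 by blast
      \<comment> \<open>The factor \<open>r\<close> moves the argument strictly inside the domain of
        \<open>arccos\<close>, where it is differentiable.\<close>
      then have "\<bar>r * (M * \<gamma> t * M\<^sup>T) $$ (i, i)\<bar> \<le> r * 1"
        unfolding abs_mult using r by (intro mult_mono) auto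
      then have "- 1 < r * (M * \<gamma> t * M\<^sup>T) $$ (i, i)" "r * (M * \<gamma> t * M\<^sup>T) $$ (i, i) < 1"
        using r by linarith+
      from DERIV_arccos[OF this]
      have "((\<lambda>t. arccos (r * (M * \<gamma> t * M\<^sup>T) $$ (i, i))) has_real_derivative
          inverse (- sqrt (1 - (r * (M * \<gamma> t * M\<^sup>T) $$ (i, i))\<^sup>2)) * (r * (M * X t * M\<^sup>T) $$ (i, i)))
          (at t within {a..b})"
        by (rule DERIV_chain2) (rule DERIV_cmult[OF d])
      from DERIV_cmult[OF this, of "w i"] show ?thesis
        by (simp add: field_simps)
    qed
    then show "(h has_vector_derivative h' t) (at t within {a..b})"
      unfolding h_def h'_def diag_angle_def has_real_derivative_iff_has_vector_derivative[symmetric]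
      by (intro DERIV_sum) auto
  qed (use ab in simp)
  moreover have "((\<lambda>t. sqrt ((\<Sum>i<n. (w i)\<^sup>2) / 2) * E t) has_integral
      sqrt ((\<Sum>i<n. (w i)\<^sup>2) / 2) * integral {a..b} E) {a..b}"
    using E by (intro has_integral_mult_right integrable_integral)
  moreover have "h' t \<le> sqrt ((\<Sum>i<n. (w i)\<^sup>2) / 2) * E t" if t: "t \<in> {a..b}" for t
  proof -
    \<comment> \<open>Orthogonal conjugation preserves the trace norm, so the speed may be measured
      in the frame \<open>M\<close>.\<close>
    have "E t = sqrt (mat_trace ((M * X t * M\<^sup>T) * (M * X t * M\<^sup>T)))"
      unfolding conj_mult[OF M X X] E_def
      by (subst mat_trace_conj[OF M mult_carrier_mat[OF X X]]) simp
    moreover have "h' t \<le> sqrt ((\<Sum>i<n. (w i)\<^sup>2) / 2)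
        * sqrt (mat_trace ((M * X t * M\<^sup>T) * (M * X t * M\<^sup>T)))"
      unfolding h'_def
    proof (rule diag_angle_deriv_le[OF SG[OF t]])
      show XM: "M * X t * M\<^sup>T \<in> carrier_mat n n" using Mc X by auto
      show "(M * X t * M\<^sup>T)\<^sup>T = M * X t * M\<^sup>T"
        "M * \<gamma> t * M\<^sup>T * (M * X t * M\<^sup>T) + M * X t * M\<^sup>T * (M * \<gamma> t * M\<^sup>T) = 0\<^sub>m n n"
        by (rule Gr_curve_tangent[OF ab t SG dS[OF t] XM]; simp)+
    qed (use w r in auto)
    ultimately show ?thesis by simp
  qed
  ultimately show "h b - h a \<le> sqrt ((\<Sum>i<n. (w i)\<^sup>2) / 2) * integral {a..b} F"
    unfolding EF by (rule has_integral_le) 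
qed

text \<open>The estimates for the pieces are added: the increments of the angle function telescope
  and the integrals over adjacent pieces combine.\<close>

lemma diag_angle_le_length:
  assumes \<gamma>: "piecewise_C1_curve n (Gr k n) \<gamma>" and M: "M \<in> orth_group n"
    and w: "\<And>i. i < n \<Longrightarrow> 0 \<le> w i" and r: "0 \<le> r" "r < 1"
  shows "diag_angle n r w (M * \<gamma> 1 * M\<^sup>T) - diag_angle n r w (M * \<gamma> 0 * M\<^sup>T)
    \<le> sqrt ((\<Sum>i<n. (w i)\<^sup>2) / 2) * curve_length n trace_metric \<gamma>"
proof -
  define F where "F t = sqrt (trace_metric (\<gamma> t) (velocity n \<gamma> t) (velocity n \<gamma> t))" for t
  define h where "h t = diag_angle n r w (M * \<gamma> t * M\<^sup>T)" for t
  let ?c = "sqrt ((\<Sum>i<n. (w i)\<^sup>2) / 2)"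
  obtain m p where p: "p 0 = 0" "p m = 1" "\<And>l. l < m \<Longrightarrow> p l < p (Suc l)"
    and C1: "\<And>l i j. l < m \<Longrightarrow> i < n \<Longrightarrow> j < n \<Longrightarrow> C1_on (\<lambda>t. \<gamma> t $$ (i, j)) {p l..p (Suc l)}"
    using \<gamma> unfolding piecewise_C1_curve_def by blast
  \<comment> \<open>Monotone break points place every piece inside \<open>{0..1}\<close>, where the
    curve is known to stay in the Grassmannian.\<close>
  have mono: "p l \<le> p l'" if "l \<le> l'" "l' \<le> m" for l l'
    using that
  proof (induction rule: dec_induct)
    case (step i)
    then show ?case using p(3)[of i] by simp
  qed simp
  \<comment> \<open>Integrability is carried through the induction because splitting the integral at
    a break point requires it.\<close>
  have "F integrable_on {p 0..p l} \<and> h (p l) - h (p 0) \<le> ?c * integral {p 0..p l} F"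
    if "l \<le> m" for l
    using that
  proof (induction l)
    case (Suc l)
    then have l: "l < m" and IH: "F integrable_on {p 0..p l}"
      "h (p l) - h (p 0) \<le> ?c * integral {p 0..p l} F" by auto
    have "\<gamma> t \<in> Gr k n" if "t \<in> {p l..p (Suc l)}" for t
      using that mono[of 0 l] mono[of "Suc l" m] l p \<gamma> by (auto simp: piecewise_C1_curve_def)
    note piece = diag_angle_le_length_piece[where \<gamma> = \<gamma> and w = w, OF p(3)[OF l] this C1[OF l] M w r,
        folded F_def h_def]
    have le: "p 0 \<le> p l" "p l \<le> p (Suc l)" using mono l by auto
    have F: "F integrable_on {p 0..p (Suc l)}"
      using Henstock_Kurzweil_Integration.integrable_combine[OF le IH(1)] piece(1) by blast
    have "integral {p 0..p l} F + integral {p l..p (Suc l)} F = integral {p 0..p (Suc l)} F"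
      by (rule Henstock_Kurzweil_Integration.integral_combine[OF le F])
    then have "?c * integral {p 0..p (Suc l)} F
        = ?c * integral {p 0..p l} F + ?c * integral {p l..p (Suc l)} F"
      by (metis distrib_left)
    then show ?case using F IH(2) piece(2) by linarith
  qed (use integrable_on_refl[of F "p 0"] in simp)
  from this[of m] show ?thesis
    by (simp add: p curve_length_def F_def[abs_def] h_def)
qed

section \<open>The minimizing curve\<close>

lemma diag_block_mat_two:
  "diag_block_mat [A, B] =
    four_block_mat A (0\<^sub>m (dim_row A) (dim_col B)) (0\<^sub>m (dim_row B) (dim_col A)) B"
  by (subst diag_block_mat.simps(2)) (simp only: diag_block_mat_singleton Let_def)

declare diag_block_mat.simps(2) [simp del]

lemma diag_block_mat_two_mult:
  fixes A B A' B' :: "'a :: comm_ring_1 mat"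
  assumes "A \<in> carrier_mat k k" "B \<in> carrier_mat m m" "A' \<in> carrier_mat k k" "B' \<in> carrier_mat m m"
  shows "diag_block_mat [A, B] * diag_block_mat [A', B'] = diag_block_mat [A * A', B * B']"
  unfolding diag_block_mat_two using assms
  by (subst mult_four_block_mat[of _ k k _ m _ m]) (auto intro!: arg_cong4[where f = four_block_mat])

lemma diag_block_mat_two_transpose:
  assumes "A \<in> carrier_mat k k" "B \<in> carrier_mat m m"
  shows "(diag_block_mat [A, B])\<^sup>T = diag_block_mat [A\<^sup>T, B\<^sup>T]"
  unfolding diag_block_mat_two using assms
  by (subst transpose_four_block_mat[of _ k k _ m _ m]) auto

lemma diag_block_mat_two_carrier:
  assumes "A \<in> carrier_mat k k" "B \<in> carrier_mat m m"
  shows "diag_block_mat [A, B] \<in> carrier_mat (k + m) (k + m)"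
  unfolding diag_block_mat_two using assms by auto

lemma diag_block_mat_two_one: "diag_block_mat [1\<^sub>m k, 1\<^sub>m m] = 1\<^sub>m (k + m)"
  unfolding diag_block_mat_two by (rule eq_matI) auto

lemma orth_group_diag_block_mat:
  assumes "A \<in> orth_group k" "B \<in> orth_group m"
  shows "diag_block_mat [A, B] \<in> orth_group (k + m)"
proof -
  note A = orth_groupD[OF assms(1)] and B = orth_groupD[OF assms(2)]
  have "(diag_block_mat [A, B])\<^sup>T * diag_block_mat [A, B] = 1\<^sub>m (k + m)"
    unfolding diag_block_mat_two_transpose[OF A(1) B(1)]
    by (subst diag_block_mat_two_mult[of _ k _ m]) (use A B in \<open>auto simp: diag_block_mat_two_one\<close>)
  then show ?thesis
    using diag_block_mat_two_carrier[OF A(1) B(1)] by (simp add: orth_group_def)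
qed

text \<open>The signature matrix is scalar on each block, so it commutes with block-diagonal
  matrices. This removes the outer factors of the CS decomposition.\<close>

lemma diag_block_mat_conj_sig_mat:
  assumes "A \<in> orth_group k" "B \<in> orth_group m"
  shows "diag_block_mat [A, B] * sig_mat k m * (diag_block_mat [A, B])\<^sup>T = sig_mat k m"
proof -
  note A = orth_groupD[OF assms(1)] and B = orth_groupD[OF assms(2)]
  have "B * (- 1\<^sub>m m) * B\<^sup>T = - 1\<^sub>m m"
    using B by simp
  then show ?thesis
    unfolding sig_mat_def diag_block_mat_two_transpose[OF A(1) B(1)]
    using A B by (simp add: diag_block_mat_two_mult[of _ k _ m])
qed

section \<open>Matrices assembled from diagonal blocks\<close>

lemma mat_diag_add: "mat_diag n f + mat_diag n g = mat_diag n (\<lambda>i. f i + g i)"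
  for f g :: "nat \<Rightarrow> 'a :: monoid_add"
  by (rule eq_matI) (auto simp: mat_diag_def)

lemma mat_diag_uminus: "- mat_diag n f = mat_diag n (\<lambda>i. - f i)"
  for f :: "nat \<Rightarrow> 'a :: group_add"
  by (rule eq_matI) (auto simp: mat_diag_def)

lemma mat_diag_transpose: "(mat_diag n f)\<^sup>T = mat_diag n f"
  by (rule eq_matI) (auto simp: mat_diag_def)

text \<open>Up to a permutation of the indices this is the direct sum of the \<open>k\<close>
  matrices with rows \<open>(a i, b i)\<close> and \<open>(c i, d i)\<close> and of \<open>e\<close>
  times the identity of size \<open>N\<close>. Products, transposes and traces can therefore be
  computed index by index.\<close>

definition cs_mat :: "nat \<Rightarrow> nat \<Rightarrow> (nat \<Rightarrow> real) \<Rightarrow> (nat \<Rightarrow> real) \<Rightarrow> (nat \<Rightarrow> real) \<Rightarrow>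
    (nat \<Rightarrow> real) \<Rightarrow> real \<Rightarrow> real mat" where
  "cs_mat k N a b c d e = diag_block_mat
     [four_block_mat (mat_diag k a) (mat_diag k b) (mat_diag k c) (mat_diag k d),
      mat_diag N (\<lambda>_. e)]"

lemma cs_mat_carrier [simp]: "cs_mat k N a b c d e \<in> carrier_mat (2 * k + N) (2 * k + N)"
  unfolding cs_mat_def mult_2 by (rule diag_block_mat_two_carrier) auto

lemma cs_mat_index:
  assumes "i < 2 * k + N" "j < 2 * k + N"
  shows "cs_mat k N a b c d e $$ (i, j) =
    (if i < k then if j = i then a i else if j = i + k then b i else 0
     else if i < 2 * k then if i = j + k then c j else if i = j then d (i - k) else 0
     else if i = j then e else 0)"
proof -
  have blk: "four_block_mat (mat_diag k a) (mat_diag k b) (mat_diag k c) (mat_diag k d) $$ (i, j) =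
      (if i < k then if j < k then mat_diag k a $$ (i, j) else mat_diag k b $$ (i, j - k)
       else if j < k then mat_diag k c $$ (i - k, j) else mat_diag k d $$ (i - k, j - k))"
    if "i < k + k" "j < k + k"
    using that by (subst index_mat_four_block) (simp_all add: mat_diag_def)
  have entry: "cs_mat k N a b c d e $$ (i, j) =
      (if i < k + k then if j < k + k
         then four_block_mat (mat_diag k a) (mat_diag k b) (mat_diag k c) (mat_diag k d) $$ (i, j)
         else 0
       else if j < k + k then 0 else mat_diag N (\<lambda>_. e) $$ (i - (k + k), j - (k + k)))"
    unfolding cs_mat_def diag_block_mat_two
    using assms by (subst index_mat_four_block) (simp_all add: mat_diag_def)
  consider "i < k" | "k \<le> i" "i < 2 * k" | "2 * k \<le> i"
    by linarith
  then show ?thesis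
    by cases (use assms in \<open>auto simp: entry blk mat_diag_def\<close>)
qed

lemma cs_mat_transpose: "(cs_mat k N a b c d e)\<^sup>T = cs_mat k N a c b d e"
proof -
  have "(four_block_mat (mat_diag k a) (mat_diag k b) (mat_diag k c) (mat_diag k d))\<^sup>T
      = four_block_mat (mat_diag k a) (mat_diag k c) (mat_diag k b) (mat_diag k d)"
    by (subst transpose_four_block_mat[of _ k k _ k _ k]) (simp_all add: mat_diag_transpose)
  moreover have "four_block_mat (mat_diag k a) (mat_diag k b) (mat_diag k c) (mat_diag k d)
      \<in> carrier_mat (k + k) (k + k)"
    by simp
  ultimately show ?thesis
    unfolding cs_mat_def
    by (simp add: diag_block_mat_two_transpose[of _ "k + k" _ N] mat_diag_transpose)
qed

lemma cs_mat_mult: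
  "cs_mat k N a b c d e * cs_mat k N a' b' c' d' e' =
    cs_mat k N (\<lambda>i. a i * a' i + b i * c' i) (\<lambda>i. a i * b' i + b i * d' i)
      (\<lambda>i. c i * a' i + d i * c' i) (\<lambda>i. c i * b' i + d i * d' i) (e * e')"
proof -
  have carr: "four_block_mat (mat_diag k f) (mat_diag k g) (mat_diag k h) (mat_diag k l)
      \<in> carrier_mat (k + k) (k + k)" for f g h l :: "nat \<Rightarrow> real"
    by simp
  have "four_block_mat (mat_diag k a) (mat_diag k b) (mat_diag k c) (mat_diag k d)
      * four_block_mat (mat_diag k a') (mat_diag k b') (mat_diag k c') (mat_diag k d')
      = four_block_mat (mat_diag k (\<lambda>i. a i * a' i + b i * c' i))
          (mat_diag k (\<lambda>i. a i * b' i + b i * d' i))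
          (mat_diag k (\<lambda>i. c i * a' i + d i * c' i)) (mat_diag k (\<lambda>i. c i * b' i + d i * d' i))"
    by (subst mult_four_block_mat[of _ k k _ k _ k _ _ k _ k]) (simp_all add: mat_diag_add)
  then show ?thesis
    unfolding cs_mat_def by (simp add: diag_block_mat_two_mult[OF carr _ carr, of _ N])
qed

lemma sum_lessThan_add: "(\<Sum>i<m + n. f i) = (\<Sum>i<m. f i) + (\<Sum>i<n. f (m + i))"
  for f :: "nat \<Rightarrow> 'a :: comm_monoid_add"
  by (induction n) (simp_all add: add.assoc)

lemma cs_mat_trace: "mat_trace (cs_mat k N a b c d e) = (\<Sum>i<k. a i) + (\<Sum>i<k. d i) + real N * e"
proof -
  have "mat_trace (cs_mat k N a b c d e)
      = (\<Sum>i<k + k + N. if i < k then a i else if i < k + k then d (i - k) else e)"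
    using carrier_matD(1)[OF cs_mat_carrier[of k N a b c d e]]
    by (auto simp: mat_trace_def cs_mat_index mult_2 intro!: sum.cong)
  also have "\<dots> = (\<Sum>i<k. a i) + (\<Sum>i<k. d i) + real N * e"
    by (simp add: sum_lessThan_add)
  finally show ?thesis .
qed

lemma cs_mat_one: "cs_mat k N (\<lambda>_. 1) (\<lambda>_. 0) (\<lambda>_. 0) (\<lambda>_. 1) 1 = 1\<^sub>m (2 * k + N)"
  using carrier_matD[OF cs_mat_carrier[of k N "\<lambda>_. 1" "\<lambda>_. 0" "\<lambda>_. 0" "\<lambda>_. 1" 1]]
  by (intro eq_matI) (auto simp: cs_mat_index)

text \<open>The negative block of size \<open>k + N\<close> is cut into a part of size
  \<open>k\<close> and a tail of size \<open>N\<close> to fit the CS block structure.\<close>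

lemma sig_mat_eq_cs_mat:
  "sig_mat k (k + N) = cs_mat k N (\<lambda>_. 1) (\<lambda>_. 0) (\<lambda>_. 0) (\<lambda>_. - 1) (- 1)"
proof -
  note carrier_matD[OF cs_mat_carrier[of k N "\<lambda>_. 1" "\<lambda>_. 0" "\<lambda>_. 0" "\<lambda>_. - 1" "- 1"]]
  then show ?thesis
    by (intro eq_matI) (auto simp: cs_mat_index sig_mat_def diag_block_mat_two)
qed

lemma cs_mat_cong:
  assumes "\<And>i. i < k \<Longrightarrow> a i = a' i" "\<And>i. i < k \<Longrightarrow> b i = b' i" "\<And>i. i < k \<Longrightarrow> c i = c' i"
    "\<And>i. i < k \<Longrightarrow> d i = d' i" "e = e'"
  shows "cs_mat k N a b c d e = cs_mat k N a' b' c' d' e'"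
proof -
  have "mat_diag k f = mat_diag k f'" if "\<And>i. i < k \<Longrightarrow> f i = f' i" for f f' :: "nat \<Rightarrow> real"
    using that by (intro eq_matI) (auto simp: mat_diag_def)
  from this[OF assms(1)] this[OF assms(2)] this[OF assms(3)] this[OF assms(4)] assms(5)
  show ?thesis by (simp only: cs_mat_def)
qed

section \<open>The CS rotation and the curve it generates\<close>

abbreviation rot_mat :: "nat \<Rightarrow> nat \<Rightarrow> (nat \<Rightarrow> real) \<Rightarrow> real mat" where
  "rot_mat k N \<theta> \<equiv> cs_mat k N (\<lambda>i. cos (\<theta> i)) (\<lambda>i. sin (\<theta> i)) (\<lambda>i. - sin (\<theta> i)) (\<lambda>i. cos (\<theta> i)) 1"

text \<open>In each plane of the direct sum this is the reflection obtained by conjugating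
  \<open>diag(1, -1)\<close> with the rotation block for the angle \<open>t * \<theta> i\<close>;
  hence the double angle.\<close>

abbreviation geod_mat :: "nat \<Rightarrow> nat \<Rightarrow> (nat \<Rightarrow> real) \<Rightarrow> real \<Rightarrow> real mat" where
  "geod_mat k N \<theta> t \<equiv> cs_mat k N (\<lambda>i. cos (2 * \<theta> i * t)) (\<lambda>i. - sin (2 * \<theta> i * t))
     (\<lambda>i. - sin (2 * \<theta> i * t)) (\<lambda>i. - cos (2 * \<theta> i * t)) (- 1)"

lemma rot_mat_conj_sig_mat:
  "rot_mat k N \<theta> * sig_mat k (k + N) * (rot_mat k N \<theta>)\<^sup>T = geod_mat k N \<theta> 1"
  unfolding sig_mat_eq_cs_mat cs_mat_transpose cs_mat_mult
  by (rule cs_mat_cong) (simp_all add: cos_double sin_double power2_eq_square)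

lemma geod_mat_0: "geod_mat k N \<theta> 0 = sig_mat k (k + N)"
  unfolding sig_mat_eq_cs_mat by (rule cs_mat_cong) auto

text \<open>The two off-diagonal blocks agree, and the square is the identity by the Pythagorean
  identity. In the trace the cosines cancel, which leaves \<open>- N = 2 * k - n\<close>.\<close>

lemma geod_mat_Gr: "geod_mat k N \<theta> t \<in> Gr k (2 * k + N)"
proof -
  have "geod_mat k N \<theta> t * geod_mat k N \<theta> t = 1\<^sub>m (2 * k + N)"
    unfolding cs_mat_mult cs_mat_one[symmetric]
    by (rule cs_mat_cong) (simp_all add: power2_eq_square[symmetric])
  then show ?thesis
    by (simp add: Gr_def orth_group_def cs_mat_transpose cs_mat_trace sum_negf)
qed

lemma mat_has_deriv_cs_mat:
  assumes "\<And>i. i < k \<Longrightarrow> ((\<lambda>t. a t i) has_real_derivative a' i) F"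
    "\<And>i. i < k \<Longrightarrow> ((\<lambda>t. b t i) has_real_derivative b' i) F"
    "\<And>i. i < k \<Longrightarrow> ((\<lambda>t. c t i) has_real_derivative c' i) F"
    "\<And>i. i < k \<Longrightarrow> ((\<lambda>t. d t i) has_real_derivative d' i) F"
  shows "mat_has_deriv (2 * k + N) (\<lambda>t. cs_mat k N (a t) (b t) (c t) (d t) e)
    (cs_mat k N a' b' c' d' 0) F"
  using assms unfolding mat_has_deriv_def by (auto simp: cs_mat_index)

definition geod_vel :: "nat \<Rightarrow> nat \<Rightarrow> (nat \<Rightarrow> real) \<Rightarrow> real \<Rightarrow> real mat" where
  "geod_vel k N \<theta> t = cs_mat k N (\<lambda>i. - (2 * \<theta> i * sin (2 * \<theta> i * t))) (\<lambda>i. - (2 * \<theta> i * cos (2 * \<theta> i * t)))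
     (\<lambda>i. - (2 * \<theta> i * cos (2 * \<theta> i * t))) (\<lambda>i. 2 * \<theta> i * sin (2 * \<theta> i * t)) 0"

lemma mat_has_deriv_geod_mat:
  "mat_has_deriv (2 * k + N) (geod_mat k N \<theta>) (geod_vel k N \<theta> t) (at t)"
  unfolding geod_vel_def
  by (rule mat_has_deriv_cs_mat) (auto intro!: derivative_eq_intros)

text \<open>Only the existence of a second derivative matters: it gives the continuity of the
  velocity that \<open>C1_on\<close> demands.\<close>

lemma mat_has_deriv_geod_vel:
  "\<exists>A\<in>carrier_mat (2 * k + N) (2 * k + N). mat_has_deriv (2 * k + N) (geod_vel k N \<theta>) A (at t)"
  unfolding geod_vel_def
  by (rule bexI, rule mat_has_deriv_cs_mat) (auto intro!: derivative_eq_intros)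

text \<open>In each plane the squared velocity is \<open>4 * (\<theta> i)\<^sup>2\<close> times the
  identity, and the trace counts this twice.\<close>

lemma mat_trace_geod_vel:
  "mat_trace (geod_vel k N \<theta> t * geod_vel k N \<theta> t) = 8 * (\<Sum>i<k. (\<theta> i)\<^sup>2)"
proof -
  have "(2 * \<theta> i * sin (2 * \<theta> i * t))\<^sup>2 + (2 * \<theta> i * cos (2 * \<theta> i * t))\<^sup>2 = 4 * (\<theta> i)\<^sup>2" for i
    by (simp add: power_mult_distrib distrib_left[symmetric])
  then show ?thesis
    by (simp add: geod_vel_def cs_mat_mult cs_mat_trace power2_eq_square[symmetric] add.commute
        sum_distrib_left)
qed

text \<open>Conjugation by \<open>P\<close> preserves both the Grassmannian and the speed, so the
  computation reduces to \<open>geod_mat\<close>.\<close>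

lemma geod_length:
  fixes P :: "real mat" and \<theta> :: "nat \<Rightarrow> real"
  assumes P: "P \<in> orth_group n" and n: "n = 2 * k + N"
  defines "\<gamma> \<equiv> \<lambda>t. P * geod_mat k N \<theta> t * P\<^sup>T"
  shows "piecewise_C1_curve n (Gr k n) \<gamma>"
    and "curve_length n trace_metric \<gamma> = 2 * sqrt 2 * sqrt (\<Sum>i<k. (\<theta> i)\<^sup>2)"
proof -
  note Pc = orth_groupD[OF P]
  have vel_c: "geod_vel k N \<theta> t \<in> carrier_mat n n" for t
    by (simp add: geod_vel_def n)
  have d: "mat_has_deriv n \<gamma> (P * geod_vel k N \<theta> t * P\<^sup>T) (at t)" for t
    unfolding \<gamma>_def
    by (rule mat_has_deriv_conj) (use mat_has_deriv_geod_mat Pc vel_c n in auto)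
  have "continuous_on S (\<lambda>t. (P * geod_vel k N \<theta> t * P\<^sup>T) $$ (i, j))" if "i < n" "j < n" for i j S
  proof (rule continuous_at_imp_continuous_on, rule ballI)
    fix t
    obtain A where "A \<in> carrier_mat n n" "mat_has_deriv n (geod_vel k N \<theta>) A (at t)"
      using mat_has_deriv_geod_vel n by blast
    then have "mat_has_deriv n (\<lambda>t. P * geod_vel k N \<theta> t * P\<^sup>T) (P * A * P\<^sup>T) (at t)"
      by (intro mat_has_deriv_conj) (use Pc vel_c in auto)
    then show "isCont (\<lambda>t. (P * geod_vel k N \<theta> t * P\<^sup>T) $$ (i, j)) t"
      using that by (auto simp: mat_has_deriv_def intro: DERIV_isCont)
  qed
  then have "C1_on (\<lambda>t. \<gamma> t $$ (i, j)) S" if "i < n" "j < n" for i j S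
    unfolding C1_on_def using d that
    by (intro exI[of _ "\<lambda>t. (P * geod_vel k N \<theta> t * P\<^sup>T) $$ (i, j)"])
       (auto simp: mat_has_deriv_def intro: has_field_derivative_at_within)
  moreover have "\<gamma> t \<in> Gr k n" for t
    unfolding \<gamma>_def using Gr_conj[OF P] geod_mat_Gr n by auto
  \<comment> \<open>A single piece suffices; the break points are \<open>real 0\<close> and
    \<open>real 1\<close>.\<close>
  ultimately show "piecewise_C1_curve n (Gr k n) \<gamma>"
    unfolding piecewise_C1_curve_def
    by (intro conjI exI[of _ "1 :: nat"] exI[of _ real]) auto
  \<comment> \<open>The curve is differentiable on the whole real line, so the velocity is known
    even at 0 and 1 and the integrand is constant.\<close>
  have "velocity n \<gamma> t = P * geod_vel k N \<theta> t * P\<^sup>T" for t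
  proof (rule eq_matI)
    have c: "P * geod_vel k N \<theta> t * P\<^sup>T \<in> carrier_mat n n"
      using Pc vel_c by auto
    fix i j assume "i < dim_row (P * geod_vel k N \<theta> t * P\<^sup>T)" "j < dim_col (P * geod_vel k N \<theta> t * P\<^sup>T)"
    then show "velocity n \<gamma> t $$ (i, j) = (P * geod_vel k N \<theta> t * P\<^sup>T) $$ (i, j)"
      using carrier_matD[OF c] d[of t] by (simp add: velocity_def mat_has_deriv_def DERIV_imp_deriv)
  qed (use Pc in \<open>auto simp: velocity_def\<close>)
  then have "trace_metric (\<gamma> t) (velocity n \<gamma> t) (velocity n \<gamma> t) = 8 * (\<Sum>i<k. (\<theta> i)\<^sup>2)" for t
    unfolding trace_metric_def
    by (simp only: conj_mult[OF P vel_c vel_c] mat_trace_conj[OF P mult_carrier_mat[OF vel_c vel_c]]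
        mat_trace_geod_vel)
  then have "curve_length n trace_metric \<gamma> = sqrt (8 * (\<Sum>i<k. (\<theta> i)\<^sup>2))"
    by (simp add: curve_length_def)
  also have "\<dots> = 2 * sqrt 2 * sqrt (\<Sum>i<k. (\<theta> i)\<^sup>2)"
    using real_sqrt_mult[of 4 2] by (simp add: real_sqrt_mult)
  finally show "curve_length n trace_metric \<gamma> = 2 * sqrt 2 * sqrt (\<Sum>i<k. (\<theta> i)\<^sup>2)" .
qed

section \<open>Singular values and the distance\<close>

lemma proots_char_poly_mat_diag:
  "proots (char_poly (mat_diag k f)) = image_mset f (mset_set {..<k})" for f :: "nat \<Rightarrow> real"
proof -
  have "char_poly (mat_diag k f) = (\<Prod>a\<leftarrow>diag_mat (mat_diag k f). [:- a, 1:])"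
    by (rule char_poly_upper_triangular[of _ k]) (auto simp: mat_diag_def)
  also have "diag_mat (mat_diag k f) = map f [0..<k]"
    by (auto simp: diag_mat_def mat_diag_def)
  also have "(\<Prod>a\<leftarrow>map f [0..<k]. [:- a, 1:]) = (\<Prod>i<k. [:- f i, 1:])"
    by (simp add: prod.list_conv_set_nth o_def atLeast0LessThan)
  finally have "proots (char_poly (mat_diag k f)) = (\<Sum>i<k. {#f i#})"
    by (simp add: proots_prod)
  also have "\<dots> = image_mset f (mset_set {..<k})"
    by (induction k) (simp_all add: lessThan_Suc)
  finally show ?thesis .
qed

text \<open>With \<open>k \<le> m\<close> the singular values come from
  \<open>B * B\<^sup>T\<close>, and similarity to a diagonal matrix determines its eigenvalues as a
  multiset. A sum does not see the order, so the sorting never has to be analysed.\<close>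

lemma sum_singular_values_sq:
  fixes f :: "nat \<Rightarrow> real"
  assumes B: "B \<in> carrier_mat k m" "k \<le> m" and U: "U \<in> orth_group k"
    and BB: "B * B\<^sup>T = U * mat_diag k f * U\<^sup>T" and f: "\<And>i. i < k \<Longrightarrow> 0 \<le> f i"
  shows "(\<Sum>i<k. (singular_values B ! i)\<^sup>2) = (\<Sum>i<k. f i)"
proof -
  note Uc = orth_groupD[OF U]
  have "similar_mat (B * B\<^sup>T) (mat_diag k f)"
    using Uc BB by (intro similar_matI[of _ _ U "U\<^sup>T" k]) auto
  then have pr: "proots (char_poly (B * B\<^sup>T)) = image_mset f (mset_set {..<k})"
    by (simp add: char_poly_similar proots_char_poly_mat_diag)
  define xs where "xs = singular_values B"
  have ms: "mset xs = image_mset (\<lambda>i. sqrt (f i)) (mset_set {..<k})"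
    using B by (simp add: xs_def singular_values_def pr image_mset.compositionality o_def)
  then have len: "length xs = k"
    by (metis size_mset size_image_mset size_mset_set card_lessThan)
  have "(\<Sum>i<k. (xs ! i)\<^sup>2) = sum_list (map (\<lambda>x. x\<^sup>2) xs)"
    by (simp add: sum_list_sum_nth len atLeast0LessThan)
  also have "\<dots> = sum_mset (image_mset (\<lambda>x. x\<^sup>2) (mset xs))"
    by (metis mset_map sum_mset_sum_list)
  also have "\<dots> = (\<Sum>i<k. (sqrt (f i))\<^sup>2)"
    by (simp add: ms image_mset.compositionality o_def sum_unfold_sum_mset)
  also have "\<dots> = (\<Sum>i<k. f i)"
    using f by simp
  finally show ?thesis by (simp add: xs_def)
qed

text \<open>\<open>V\<^sup>T * V = 1\<close> cancels in the middle, so the right orthogonal factor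
  leaves no trace in the Gram matrix.\<close>

lemma mult_orth_gram:
  fixes A U V :: "real mat"
  assumes A: "A \<in> carrier_mat k m" and U: "U \<in> carrier_mat k k" and V: "V \<in> orth_group m"
  shows "(U * A * V\<^sup>T) * (U * A * V\<^sup>T)\<^sup>T = U * (A * A\<^sup>T) * U\<^sup>T"
proof -
  note Vc = orth_groupD[OF V]
  define C where "C = U * A"
  have C: "C \<in> carrier_mat k m" using A U by (simp add: C_def)
  have CT: "C\<^sup>T = A\<^sup>T * U\<^sup>T"
    unfolding C_def using U A by (rule transpose_mult)
  have "(C * V\<^sup>T)\<^sup>T = V * C\<^sup>T"
    using transpose_mult[OF C, of "V\<^sup>T" m] Vc by simp
  then have "(C * V\<^sup>T) * (C * V\<^sup>T)\<^sup>T = C * (V\<^sup>T * (V * C\<^sup>T))"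
    using C Vc by (simp add: assoc_mult_mat[of C k m _ m _ k])
  also have "V\<^sup>T * (V * C\<^sup>T) = V\<^sup>T * V * C\<^sup>T"
    using C Vc by (intro assoc_mult_mat[symmetric, of _ m m _ m _ k]) auto
  also have "\<dots> = C\<^sup>T"
    using C Vc by simp
  also have "C * C\<^sup>T = U * (A * (A\<^sup>T * U\<^sup>T))"
    unfolding CT unfolding C_def using U A by (intro assoc_mult_mat[of _ k k _ m _ k]) auto
  also have "A * (A\<^sup>T * U\<^sup>T) = A * A\<^sup>T * U\<^sup>T"
    using U A by (intro assoc_mult_mat[symmetric, of _ k m _ k _ k]) auto
  also have "U * (A * A\<^sup>T * U\<^sup>T) = U * (A * A\<^sup>T) * U\<^sup>T"
    using U A by (intro assoc_mult_mat[symmetric, of _ k k _ k _ k]) auto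
  finally show ?thesis by (simp only: C_def)
qed

section \<open>The limit \<open>r\<close> to 1 and the lower bound by the angles\<close>

text \<open>\<open>arccos\<close> is continuous up to the ends of its domain although it is not
  differentiable there, so the exact angles are recovered as \<open>r\<close> tends to 1 from
  below.\<close>

lemma diag_angle_tendsto:
  assumes "\<And>i. i < n \<Longrightarrow> \<bar>S $$ (i, i)\<bar> \<le> 1"
  shows "((\<lambda>r. diag_angle n r w S) \<longlongrightarrow> diag_angle n 1 w S) (at_left 1)"
  unfolding diag_angle_def
proof (intro tendsto_sum tendsto_mult_left)
  fix i assume "i \<in> {..<n}"
  then have S: "\<bar>S $$ (i, i)\<bar> \<le> 1" using assms by simp
  have "((\<lambda>r. r * S $$ (i, i)) \<longlongrightarrow> 1 * S $$ (i, i)) (at_left 1)"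
    by (intro tendsto_intros)
  moreover have "\<forall>\<^sub>F r in at_left 1. r * S $$ (i, i) \<in> {- 1..1}"
  proof -
    have "r * S $$ (i, i) \<in> {- 1..1}" if "r \<in> {0<..<1}" for r :: real
    proof -
      have "\<bar>r * S $$ (i, i)\<bar> \<le> 1 * 1"
        unfolding abs_mult by (intro mult_mono) (use that S in auto)
      then show ?thesis by auto
    qed
    then show ?thesis
      by (intro eventually_mono[OF eventually_at_left_real[of 0 1]]) auto
  qed
  ultimately show "((\<lambda>r. arccos (r * S $$ (i, i))) \<longlongrightarrow> arccos (1 * S $$ (i, i))) (at_left 1)"
    by (intro continuous_on_tendsto_compose[OF continuous_on_arccos']) (use S in auto)
qed

lemma curve_length_ge_angles:
  assumes P: "P \<in> orth_group n" and n: "n = 2 * k + N" and k: "1 \<le> k"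
    and \<theta>: "\<And>i. i < k \<Longrightarrow> \<theta> i \<in> {0..pi / 2}"
    and \<gamma>: "piecewise_C1_curve n (Gr k n) \<gamma>"
    and ends: "\<gamma> 0 = P * geod_mat k N \<theta> 0 * P\<^sup>T" "\<gamma> 1 = P * geod_mat k N \<theta> 1 * P\<^sup>T"
  shows "2 * sqrt 2 * sqrt (\<Sum>i<k. (\<theta> i)\<^sup>2) \<le> curve_length n trace_metric \<gamma>"
proof -
  let ?L = "curve_length n trace_metric \<gamma>" and ?s = "\<Sum>i<k. (\<theta> i)\<^sup>2"
  \<comment> \<open>The weights stay general because two choices follow: \<open>\<theta>\<close>
    itself, and constant 1 when all angles vanish.\<close>
  have len: "2 * (\<Sum>i<k. w i * \<theta> i) \<le> sqrt ((\<Sum>i<k. (w i)\<^sup>2) / 2) * ?L"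
    if w: "\<And>i. i < k \<Longrightarrow> 0 \<le> w i" for w
  proof -
    \<comment> \<open>Extension by zero, so that only the first \<open>k\<close> diagonal entries,
      the cosines, are seen.\<close>
    define w' where "w' i = (if i < k then w i else 0)" for i
    have restrict: "(\<Sum>i<n. if i < k then f i else 0) = (\<Sum>i<k. f i)" for f :: "nat \<Rightarrow> real"
      unfolding n mult_2 by (simp add: sum_lessThan_add)
    \<comment> \<open>The frame \<open>P\<^sup>T\<close> brings both end points of the curve to
      normal form.\<close>
    have G: "P\<^sup>T * \<gamma> 0 * P\<^sup>T\<^sup>T = geod_mat k N \<theta> 0" "P\<^sup>T * \<gamma> 1 * P\<^sup>T\<^sup>T = geod_mat k N \<theta> 1"
      unfolding ends by (simp_all add: conj_conj_transpose[OF P] n)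
    have da: "diag_angle n 1 w' (geod_mat k N \<theta> t) = (\<Sum>i<k. w i * arccos (cos (2 * \<theta> i * t)))" for t
    proof -
      have "diag_angle n 1 w' (geod_mat k N \<theta> t)
          = (\<Sum>i<n. if i < k then w i * arccos (cos (2 * \<theta> i * t)) else 0)"
        unfolding diag_angle_def by (intro sum.cong) (auto simp: w'_def cs_mat_index n)
      then show ?thesis by (simp only: restrict)
    qed
    have le1: "\<bar>geod_mat k N \<theta> t $$ (i, i)\<bar> \<le> 1" if "i < n" for i t
      using Gr_diag_le[OF geod_mat_Gr] that abs_square_le_1 unfolding n by blast
    have w'2: "(\<Sum>i<n. (w' i)\<^sup>2) = (\<Sum>i<k. (w i)\<^sup>2)"
      unfolding restrict[symmetric] by (intro sum.cong) (auto simp: w'_def)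
    \<comment> \<open>The right-hand side does not involve \<open>r\<close>, so the estimate
      survives the limit.\<close>
    have "\<forall>\<^sub>F r in at_left 1. diag_angle n r w' (geod_mat k N \<theta> 1) - diag_angle n r w' (geod_mat k N \<theta> 0)
        \<le> sqrt ((\<Sum>i<k. (w i)\<^sup>2) / 2) * ?L"
    proof (rule eventually_mono[OF eventually_at_left_real[of 0 1]])
      fix r :: real assume "r \<in> {0<..<1}"
      then show "diag_angle n r w' (geod_mat k N \<theta> 1) - diag_angle n r w' (geod_mat k N \<theta> 0)
          \<le> sqrt ((\<Sum>i<k. (w i)\<^sup>2) / 2) * ?L"
        using diag_angle_le_length[OF \<gamma> orth_group_transpose[OF P], of w' r] w
        unfolding G w'2 by (auto simp: w'_def)
    qed simp
    then have "diag_angle n 1 w' (geod_mat k N \<theta> 1) - diag_angle n 1 w' (geod_mat k N \<theta> 0)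
        \<le> sqrt ((\<Sum>i<k. (w i)\<^sup>2) / 2) * ?L"
      by (rule tendsto_upperbound[OF tendsto_diff[OF diag_angle_tendsto diag_angle_tendsto], rotated 2])
         (rule le1, assumption | simp)+
    moreover have "(\<Sum>i<k. w i * arccos (cos (2 * \<theta> i * 1))) = 2 * (\<Sum>i<k. w i * \<theta> i)"
    proof -
      \<comment> \<open>Here \<open>\<theta> i \<le> pi / 2\<close> enters:
        \<open>2 * \<theta> i\<close> lies in \<open>{0..pi}\<close>, the range on which
        \<open>arccos\<close> inverts \<open>cos\<close>.\<close>
      have "arccos (cos (2 * \<theta> i * 1)) = 2 * \<theta> i" if "i < k" for i
        using \<theta>[OF that] by (simp add: arccos_cos)
      then show ?thesis
        by (simp add: sum_distrib_left mult.left_commute)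
    qed
    ultimately show ?thesis unfolding da by simp
  qed
  show ?thesis
  proof (cases "?s = 0")
    case True
    \<comment> \<open>The integrand is junk at break points, so even \<open>0 \<le> ?L\<close> needs the bound, with weights 1.\<close>
    have "0 \<le> 2 * (\<Sum>i<k. 1 * \<theta> i)"
      using \<theta> by (auto intro!: sum_nonneg)
    also have "\<dots> \<le> sqrt (real k / 2) * ?L"
      using len[of "\<lambda>_. 1"] by simp
    finally show ?thesis
      using k True by (simp add: zero_le_mult_iff)
  next
    case False
    then have s: "0 < ?s" by (simp add: order_less_le sum_nonneg)
    have "2 * ?s \<le> sqrt (?s / 2) * ?L"
      using len[of \<theta>] \<theta> by (simp add: power2_eq_square)
    \<comment> \<open>The growth of the angle function is written as its constant times the claimed
      bound, so that the positive constant cancels.\<close>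
    also have "2 * ?s = sqrt (?s / 2) * (2 * sqrt 2 * sqrt ?s)"
      using s by (simp add: real_sqrt_divide)
    finally show ?thesis
      using s by (simp add: mult_le_cancel_left_pos)
  qed
qed

section \<open>The distance formula, assembled in a frame adapted to both points\<close>

theorem corollary4p6:
  fixes k n :: nat
    and Q0 Q1 V0 V1 U V W Z B :: "real mat"
    and \<theta> :: "nat \<Rightarrow> real"
  assumes "1 \<le> k" and "real k \<le> real n / 2"
    and "Q0 \<in> Gr k n" and "Q1 \<in> Gr k n"
    and "V0 \<in> orth_group n" and "V1 \<in> orth_group n"
    and "Q0 = V0 * sig_mat k (n - k) * V0\<^sup>T"
    and "Q1 = V1 * sig_mat k (n - k) * V1\<^sup>T"
    and "U \<in> orth_group k" and "W \<in> orth_group k"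
    and "V \<in> orth_group (n - k)" and "Z \<in> orth_group (n - k)"
    and "\<And>i. i < k \<Longrightarrow> \<theta> i \<in> {0..pi / 2}"
    and "V0\<^sup>T * V1 =
      diag_block_mat [U, V] *
      diag_block_mat
        [four_block_mat
           (mat_diag k (\<lambda>i. cos (\<theta> i)))   (mat_diag k (\<lambda>i. sin (\<theta> i)))
           (- mat_diag k (\<lambda>i. sin (\<theta> i))) (mat_diag k (\<lambda>i. cos (\<theta> i))),
         1\<^sub>m (n - 2 * k)] *
      (diag_block_mat [W, Z])\<^sup>T"
    and "B = (- 2) \<cdot>\<^sub>m (U * append_cols (mat_diag k \<theta>) (0\<^sub>m k (n - 2 * k)) * V\<^sup>T)"
  shows "Gr_dist k n Q0 Q1 = sqrt 2 * sqrt (\<Sum>i<k. (singular_values B ! i)\<^sup>2)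
    \<and> sqrt 2 * sqrt (\<Sum>i<k. (singular_values B ! i)\<^sup>2) = 2 * sqrt 2 * sqrt (\<Sum>i<k. (\<theta> i)\<^sup>2)"
proof -
  define N where "N = n - 2 * k"
  \<comment> \<open>\<open>2 * k \<le> n\<close> makes the subtractions of natural numbers
    exact.\<close>
  have n: "n = 2 * k + N" "n - k = k + N" "k + (k + N) = n" using assms(2) by (auto simp: N_def)
  let ?s = "\<Sum>i<k. (\<theta> i)\<^sup>2"
  define J where "J = sig_mat k (k + N)"
  define D where "D = diag_block_mat [U, V]"
  define E where "E = diag_block_mat [W, Z]"
  define R where "R = rot_mat k N \<theta>"
  \<comment> \<open>\<open>P\<close> absorbs the left CS factor. In this frame \<open>Q0\<close> is
    the signature matrix and \<open>Q1\<close> is its conjugate by the rotation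
    \<open>R\<close>.\<close>
  define P where "P = V0 * D"
  have D: "D \<in> orth_group n" and E: "E \<in> orth_group n"
    unfolding D_def E_def using orth_group_diag_block_mat assms(9-12) n by metis+
  have P: "P \<in> orth_group n"
    unfolding P_def by (rule orth_group_mult[OF assms(5) D])
  note V0c = orth_groupD[OF assms(5)] and V1c = orth_groupD[OF assms(6)]
    and Dc = orth_groupD[OF D] and Ec = orth_groupD[OF E] and Pc = orth_groupD[OF P]
    and Uc = orth_groupD[OF assms(9)] and Vc = orth_groupD[OF assms(11)]
  have Rc: "R \<in> carrier_mat n n" and Jc: "J \<in> carrier_mat n n"
    by (simp_all add: R_def J_def sig_mat_eq_cs_mat n)
  \<comment> \<open>These identities make \<open>D\<close> disappear from \<open>Q0\<close> and
    \<open>E\<close> from \<open>Q1\<close>.\<close>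
  have DJ: "D * J * D\<^sup>T = J" and EJ: "E\<^sup>T * J * E = J"
  proof -
    show "D * J * D\<^sup>T = J"
      unfolding D_def J_def using diag_block_mat_conj_sig_mat assms(9,11) n by metis
    have "E * J * E\<^sup>T = J"
      unfolding E_def J_def using diag_block_mat_conj_sig_mat assms(10,12) n by metis
    then show "E\<^sup>T * J * E = J"
      using conj_conj_transpose[OF E Jc] by simp
  qed
  have CS: "V0\<^sup>T * V1 = D * R * E\<^sup>T"
    unfolding assms(14) D_def E_def R_def cs_mat_def by (simp add: mat_diag_uminus N_def)
  have "V1 = V0 * V0\<^sup>T * V1"
    using V0c V1c by simp
  also have "\<dots> = V0 * (D * R * E\<^sup>T)"
    unfolding CS[symmetric] by (rule assoc_mult_mat) (use V0c V1c in auto)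
  also have "\<dots> = P * (R * E\<^sup>T)"
    unfolding P_def using V0c(1) Dc(1) Rc Ec(1) by (simp add: assoc_mult_mat[of _ n n _ n _ n])
  finally have V1: "V1 = P * (R * E\<^sup>T)" .
  have RE: "R * E\<^sup>T \<in> carrier_mat n n" using Rc Ec by auto
  have "V1\<^sup>T = (R * E\<^sup>T)\<^sup>T * P\<^sup>T"
    unfolding V1 using Pc(1) RE by (rule transpose_mult)
  also have "(R * E\<^sup>T)\<^sup>T = E * R\<^sup>T"
    using transpose_mult[OF Rc, of "E\<^sup>T" n] Ec by simp
  finally have V1T: "V1\<^sup>T = E * R\<^sup>T * P\<^sup>T" .
  have "Q1 = P * (R * (E\<^sup>T * J * E) * R\<^sup>T) * P\<^sup>T"
    unfolding assms(8) V1T n(2) J_def[symmetric] unfolding V1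
    using Pc(1) Rc Ec(1) Jc by (simp add: assoc_mult_mat[of _ n n _ n _ n])
  then have Q1: "Q1 = P * geod_mat k N \<theta> 1 * P\<^sup>T"
    unfolding EJ unfolding R_def J_def rot_mat_conj_sig_mat .
  have "P\<^sup>T = D\<^sup>T * V0\<^sup>T"
    unfolding P_def using V0c(1) Dc(1) by (rule transpose_mult)
  then have "P * J * P\<^sup>T = V0 * (D * J * D\<^sup>T) * V0\<^sup>T"
    unfolding P_def using V0c(1) Dc(1) Jc by (simp add: assoc_mult_mat[of _ n n _ n _ n])
  then have Q0: "Q0 = P * geod_mat k N \<theta> 0 * P\<^sup>T"
    unfolding DJ geod_mat_0 J_def[symmetric] assms(7) n(2) by simp
  have dist: "Gr_dist k n Q0 Q1 = 2 * sqrt 2 * sqrt ?s"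
    unfolding Gr_dist_def riemannian_dist_def
  \<comment> \<open>The infimum is attained by the curve of \<open>geod_length\<close>.\<close>
  proof (rule cInf_eq_minimum)
    show "2 * sqrt 2 * sqrt ?s \<in> {curve_length n trace_metric \<gamma> |\<gamma>.
        piecewise_C1_curve n (Gr k n) \<gamma> \<and> \<gamma> 0 = Q0 \<and> \<gamma> 1 = Q1}"
      using geod_length[OF P n(1), of \<theta>] Q0 Q1 by force
  next
    fix l assume "l \<in> {curve_length n trace_metric \<gamma> |\<gamma>.
        piecewise_C1_curve n (Gr k n) \<gamma> \<and> \<gamma> 0 = Q0 \<and> \<gamma> 1 = Q1}"
    then obtain \<gamma> where l: "l = curve_length n trace_metric \<gamma>"
      and \<gamma>: "piecewise_C1_curve n (Gr k n) \<gamma>" "\<gamma> 0 = Q0" "\<gamma> 1 = Q1" by blast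
    show "2 * sqrt 2 * sqrt ?s \<le> l"
      unfolding l
    proof (rule curve_length_ge_angles[OF P n(1) assms(1) _ \<gamma>(1)])
      show "\<theta> i \<in> {0..pi / 2}" if "i < k" for i
        using assms(13) that .
    qed (simp_all only: \<gamma> Q0 Q1)
  qed
  let ?A = "append_cols (mat_diag k \<theta>) (0\<^sub>m k N)"
  have A: "?A \<in> carrier_mat k (k + N)"
    unfolding append_cols_def by (auto simp: mat_diag_def)
  have A_index: "?A $$ (i, l) = (if l = i then \<theta> i else 0)" if "i < k" "l < k + N" for i l
    using that unfolding append_cols_def by (auto simp: mat_diag_def)
  have AA: "?A * ?A\<^sup>T = mat_diag k (\<lambda>i. (\<theta> i)\<^sup>2)"
  proof (rule eq_matI)
    fix i j assume "i < dim_row (mat_diag k (\<lambda>i. (\<theta> i)\<^sup>2))" "j < dim_col (mat_diag k (\<lambda>i. (\<theta> i)\<^sup>2))"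
    then have ij: "i < k" "j < k" by (simp_all add: mat_diag_def)
    have "(?A * ?A\<^sup>T) $$ (i, j) = (\<Sum>l<k + N. ?A $$ (i, l) * ?A $$ (j, l))"
      using carrier_matD[OF A] ij by (simp add: scalar_prod_def atLeast0LessThan)
    also have "\<dots> = (\<Sum>l<k + N. if l = i then \<theta> i * (if l = j then \<theta> j else 0) else 0)"
      using ij by (intro sum.cong) (auto simp: A_index)
    also have "\<dots> = mat_diag k (\<lambda>i. (\<theta> i)\<^sup>2) $$ (i, j)"
      using ij by (simp add: mat_diag_def power2_eq_square)
    finally show "(?A * ?A\<^sup>T) $$ (i, j) = mat_diag k (\<lambda>i. (\<theta> i)\<^sup>2) $$ (i, j)" .
  qed (use A in \<open>auto simp: mat_diag_def\<close>)
  have UAV: "U * ?A * V\<^sup>T \<in> carrier_mat k (k + N)" using Uc A Vc n by auto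
  have Bc: "B \<in> carrier_mat k (k + N)"
    unfolding assms(15) N_def[symmetric] using UAV by simp
  have "((- 2) \<cdot>\<^sub>m C) * ((- 2) \<cdot>\<^sub>m C)\<^sup>T = 4 \<cdot>\<^sub>m (C * C\<^sup>T)"
    if "C \<in> carrier_mat k (k + N)" for C :: "real mat"
    using that by (intro eq_matI) (auto simp: scalar_prod_def sum_distrib_left intro!: sum.cong)
  from this[OF UAV] have "B * B\<^sup>T = 4 \<cdot>\<^sub>m ((U * ?A * V\<^sup>T) * (U * ?A * V\<^sup>T)\<^sup>T)"
    unfolding assms(15) N_def[symmetric] .
  also have "(U * ?A * V\<^sup>T) * (U * ?A * V\<^sup>T)\<^sup>T = U * (?A * ?A\<^sup>T) * U\<^sup>T"
    by (rule mult_orth_gram[OF A Uc(1)]) (use assms(11) n(2) in simp)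
  \<comment> \<open>The square of the factor \<open>- 2\<close> moves inside the conjugation, so
    that the middle matrix carries the eigenvalues \<open>4 * (\<theta> i)\<^sup>2\<close> of
    \<open>B * B\<^sup>T\<close>.\<close>
  also have "4 \<cdot>\<^sub>m \<dots> = U * (4 \<cdot>\<^sub>m (?A * ?A\<^sup>T)) * U\<^sup>T"
    using Uc(1) A by (simp add: mult_smult_distrib[of _ k k _ k] mult_smult_assoc_mat[of _ k k _ k])
  also have "4 \<cdot>\<^sub>m (?A * ?A\<^sup>T) = mat_diag k (\<lambda>i. 4 * (\<theta> i)\<^sup>2)"
    unfolding AA by (rule eq_matI) (auto simp: mat_diag_def)
  finally have "(\<Sum>i<k. (singular_values B ! i)\<^sup>2) = (\<Sum>i<k. 4 * (\<theta> i)\<^sup>2)"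
    by (intro sum_singular_values_sq[OF Bc _ assms(9)]) auto
  then have "sqrt (\<Sum>i<k. (singular_values B ! i)\<^sup>2) = 2 * sqrt ?s"
    by (simp add: sum_distrib_left[symmetric] real_sqrt_mult)
  then show ?thesis using dist by simp
qed

end
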